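(* Let $X$ be a Hopf algebra with invertible antipode in a braided monoidal category $\mathcal{X}$ (with braiding $c$), having a dual Hopf algebra $X^*$ in $\mathcal{X}$, and let $\Omega:DX\text{-mod}\to DX^*\text{-mod}$ be the category equivalence between Yetter-Drinfeld modules over $X$ and over $X^*$ inside $\mathcal{X}$ described in the context. Consider the $(X\text{-mod})$-$(X^*\text{-mod})$-bimodule category $\mathcal{M}$ defined as follows: as a category $\mathcal{M}=\mathcal{X}$; the left action of $V\in X\text{-mod}$ and the right action of $W\in X^*\text{-mod}$ on $M\in\mathcal{X}$ are $V\otimes M$ and $M\otimes W$, forgetting the $X$- resp. $X^*$-module structure, with trivial module category constraints on either side; the bimodule category constraint $a_{V,M,W}:(V\otimes M)\otimes W\to V\otimes(M\otimes W)$ is the composite $$V\otimes M\otimes W\xrightarrow{\ \mathrm{id}\otimes\mathrm{id}\otimes\delta_W\ }V\otimes M\otimes X\otimes W\xrightarrow{\ c^{-1}_{X,V\otimes M}\otimes\mathrm{id}\ }X\otimes V\otimes M\otimes W\xrightarrow{\ \rho_V\otimes\mathrm{id}\otimes\mathrm{id}\ }V\otimes M\otimes W .$$ Then $\mathcal{M}$ (which is not necessarily invertible) fulfills the defining property of the preimage of $\Omega$ under the functor $\Phi$: there are isomorphisms $\psi_{Z,M}:Z\otimes M\to M\otimes\Omega(Z)$, natural in $Z\in DX\text{-mod}$ and $M\in\mathcal{X}$, such that for all $V\in X\text{-mod}$ and $W\in X^*\text{-mod}$: (i) $\psi_{Z,V\otimes M}$ equals $Z\otimes(V\otimes M)\to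 V\otimes(Z\otimes M)\to V\otimes(M\otimes\Omega(Z))\to(V\otimes M)\otimes\Omega(Z)$, the composite of the half-braiding $\tau_{Z,V}\otimes\mathrm{id}_M$, of $\mathrm{id}_V\otimes\psi_{Z,M}$, and of $a^{-1}_{V,M,\Omega(Z)}$; (ii) $\psi_{Z,M\otimes W}\circ a_{Z,M,W}$ equals $(Z\otimes M)\otimes W\to(M\otimes\Omega(Z))\otimes W\to(M\otimes W)\otimes\Omega(Z)$, the composite of $\psi_{Z,M}\otimes\mathrm{id}_W$ and of $\mathrm{id}_M\otimes\tau_{\Omega(Z),W}$.
   Context: Let $c_{A,B}:A\otimes B\to B\otimes A$ be the braiding of $\mathcal{X}$ (associators suppressed). Module and comodule mean left module and left comodule in $\mathcal{X}$, with structure maps $\rho$ and $\delta$. $X\text{-mod}$ is the monoidal category of $X$-modules in $\mathcal{X}$. $DX\text{-mod}$ is the category of (left-left) Yetter-Drinfeld modules over $X$ in $\mathcal{X}$, with half-braiding, for $Z\in DX\text{-mod}$ and $V\in X\text{-mod}$, $$\tau_{Z,V}=(\rho_V\otimes\mathrm{id}_Z)\circ(\mathrm{id}_X\otimes c_{Z,V})\circ(\delta_Z\otimes\mathrm{id}_V):Z\otimes V\to V\otimes Z.$$ The same formula, with $X^*$ in place of $X$, defines $\tau$ for $DX^*\text{-mod}$ and $X^*\text{-mod}$. $X^*$ is the dual of $X$ with $\mathrm{ev}:X\otimes X^*\to 1$, $\mathrm{coev}:1\to X^*\otimes X$, made a Hopf algebra in $\mathcal{X}$ by dualizing the structure maps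 of $X$ via the nested pairings $X\otimes X\otimes X^*\otimes X^*\to 1$. The equivalence $\Omega$ (Barvels-Lentner-Schweigert) sends $(M,\rho_M,\delta_M)\in DX\text{-mod}$ to the same object $M\in\mathcal{X}$ with $X^*$-action $$X^*\otimes M\xrightarrow{c_{X^*,M}}M\otimes X^*\xrightarrow{\delta_M\otimes\mathrm{id}}X\otimes M\otimes X^*\xrightarrow{c^{-1}_{M,X}\otimes\mathrm{id}}M\otimes X\otimes X^*\xrightarrow{\mathrm{id}\otimes\mathrm{ev}}M$$ and $X^*$-coaction $M\xrightarrow{\mathrm{coev}\otimes\mathrm{id}}X^*\otimes X\otimes M\xrightarrow{\mathrm{id}\otimes\rho_M}X^*\otimes M$. Its monoidal structure $\Omega_2(M,N):\Omega(M)\otimes\Omega(N)\to\Omega(M\otimes N)$ is $(\mathrm{id}_M\otimes\rho_N)(\mathrm{id}_M\otimes S^{-1}\otimes\mathrm{id}_N)(c^{-1}_{M,X}\otimes\mathrm{id}_N)(\delta_M\otimes\mathrm{id}_N)$. For $W\in X^*\text{-mod}$, $\delta_W:W\to X\otimes W$ denotes the unique $X$-coaction from which the $X^*$-action on $W$ is obtained by the formula for the $X^*$-action of $\Omega$ above; explicitly $\delta_W=c_{W,X}\circ(\rho_W\otimes\mathrm{id}_X)\circ(c^{-1}_{X^*,W}\otimes\mathrm{id}_X)\circ(\mathrm{id}_W\otimes\mathrm{coev})$. For $W=\Omega(Z)$ this is the original $X$-coaction of $Z$. In (i), (ii) an object $Z\in DX\text{-mod}$ is also regarded as an $X$-module and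 $\Omega(Z)$ as an $X^*$-module by forgetting coactions. Background on $\Phi$: for tensor categories $\mathcal{C},\mathcal{D}$ the Etingof-Nikshych-Ostrik functor $\Phi$ assigns to an invertible $\mathcal{C}$-$\mathcal{D}$-bimodule category $\mathcal{M}$ a braided equivalence $\Phi(\mathcal{M}):\mathcal{Z}(\mathcal{C})\to\mathcal{Z}(\mathcal{D})$ whose defining property is that the bimodule endofunctors $m\mapsto Z.m$ and $m\mapsto m.\Phi(\mathcal{M})(Z)$ of $\mathcal{M}$ are naturally equivalent compatibly with the left and right module and bimodule constraints; (i) and (ii) spell out this compatibility for $\Omega$.
   Formalization: That M with the given constraint a is a bimodule category is assumed, not asserted: for a general braiding the right pentagon fails and no ψ satisfies (i) and (ii); the assumption forces the double braiding of X with every object to be trivial (automatic if the braiding is symmetric). *)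

theory Defs
  imports Main
begin

section \<open>Categories and braided monoidal categories\<close>

text \<open>
  Objects form a set \<open>Obj C\<close>; arrows are given by hom sets \<open>Hom C A B\<close>.  The hom sets are not
  required to be disjoint, so the same arrow of \<open>\<X>\<close> may be used between any modules whose
  structure it respects.  Composition is in applicative order and binds weaker than
  \<open>\<otimes>\<close> (on arrows) and \<open>\<boxtimes>\<close> (on objects).
\<close>

record ('o, 'm) category =
  Obj  :: "'o set"
  Hom  :: "'o \<Rightarrow> 'o \<Rightarrow> 'm set"
  Idn  :: "'o \<Rightarrow> 'm"  ("\<ii>\<index>")
  Comp :: "'m \<Rightarrow> 'm \<Rightarrow> 'm"  (infixr "\<cdot>\<index>" 55)

locale category =
  fixes C :: "('o, 'm, 'z) category_scheme" (structure)
  assumes Idn_in_Hom: "A \<in> Obj C \<Longrightarrow> \<ii> A \<in> Hom C A A"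
    and Comp_in_Hom:
      "\<lbrakk>A \<in> Obj C; B \<in> Obj C; D \<in> Obj C; f \<in> Hom C A B; g \<in> Hom C B D\<rbrakk> \<Longrightarrow> g \<cdot> f \<in> Hom C A D"
    and Comp_Idn: "\<lbrakk>A \<in> Obj C; B \<in> Obj C; f \<in> Hom C A B\<rbrakk> \<Longrightarrow> f \<cdot> \<ii> A = f"
    and Idn_Comp: "\<lbrakk>A \<in> Obj C; B \<in> Obj C; f \<in> Hom C A B\<rbrakk> \<Longrightarrow> \<ii> B \<cdot> f = f"
    and Comp_assoc:
      "\<lbrakk>A \<in> Obj C; B \<in> Obj C; D \<in> Obj C; E \<in> Obj C;
        f \<in> Hom C A B; g \<in> Hom C B D; h \<in> Hom C D E\<rbrakk> \<Longrightarrow> (h \<cdot> g) \<cdot> f = h \<cdot> (g \<cdot> f)"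

context
  fixes C :: "('o, 'm, 'z) category_scheme" (structure)
begin

definition inverse_arrows :: "'o \<Rightarrow> 'o \<Rightarrow> 'm \<Rightarrow> 'm \<Rightarrow> bool" where
  "inverse_arrows A B f g \<longleftrightarrow>
     f \<in> Hom C A B \<and> g \<in> Hom C B A \<and> g \<cdot> f = \<ii> A \<and> f \<cdot> g = \<ii> B"

definition is_iso :: "'o \<Rightarrow> 'o \<Rightarrow> 'm \<Rightarrow> bool" where
  "is_iso A B f \<longleftrightarrow> (\<exists>g. inverse_arrows A B f g)"

definition inverse_arrow :: "'o \<Rightarrow> 'o \<Rightarrow> 'm \<Rightarrow> 'm" where
  "inverse_arrow A B f = (THE g. inverse_arrows A B f g)"

end

text \<open>\<open>assoc A B D : (A \<boxtimes> B) \<boxtimes> D \<rightarrow> A \<boxtimes> (B \<boxtimes> D)\<close>, \<open>lunit A : \<one> \<boxtimes> A \<rightarrow> A\<close>, \<open>runit A : A \<boxtimes> \<one> \<rightarrow> A\<close>.\<close>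

record ('o, 'm) monoidal = "('o, 'm) category" +
  tensor_ob :: "'o \<Rightarrow> 'o \<Rightarrow> 'o"  (infixr "\<boxtimes>\<index>" 70)
  tensor    :: "'m \<Rightarrow> 'm \<Rightarrow> 'm"  (infixr "\<otimes>\<index>" 70)
  unit_ob   :: "'o"  ("\<one>\<index>")
  assoc     :: "'o \<Rightarrow> 'o \<Rightarrow> 'o \<Rightarrow> 'm"  ("\<alpha>\<index>")
  lunit     :: "'o \<Rightarrow> 'm"  ("\<ll>\<index>")
  runit     :: "'o \<Rightarrow> 'm"  ("\<rr>\<index>")

context
  fixes C :: "('o, 'm, 'z) monoidal_scheme" (structure)
begin

definition assoc_inv :: "'o \<Rightarrow> 'o \<Rightarrow> 'o \<Rightarrow> 'm" where
  "assoc_inv A B D = inverse_arrow C ((A \<boxtimes> B) \<boxtimes> D) (A \<boxtimes> (B \<boxtimes> D)) (\<alpha> A B D)"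

definition lunit_inv :: "'o \<Rightarrow> 'm" where
  "lunit_inv A = inverse_arrow C (\<one> \<boxtimes> A) A (\<ll> A)"

definition runit_inv :: "'o \<Rightarrow> 'm" where
  "runit_inv A = inverse_arrow C (A \<boxtimes> \<one>) A (\<rr> A)"

end

notation assoc_inv ("\<alpha>''\<index>")
notation lunit_inv ("\<ll>''\<index>")
notation runit_inv ("\<rr>''\<index>")

locale monoidal_category = category C for C :: "('o, 'm, 'z) monoidal_scheme" (structure) +
  assumes unit_ob_in_Obj: "\<one> \<in> Obj C"
    and tensor_ob_in_Obj: "\<lbrakk>A \<in> Obj C; B \<in> Obj C\<rbrakk> \<Longrightarrow> A \<boxtimes> B \<in> Obj C"
    and tensor_in_Hom:
      "\<lbrakk>A \<in> Obj C; A' \<in> Obj C; B \<in> Obj C; B' \<in> Obj C; f \<in> Hom C A A'; g \<in> Hom C B B'\<rbrakk>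
       \<Longrightarrow> f \<otimes> g \<in> Hom C (A \<boxtimes> B) (A' \<boxtimes> B')"
    and tensor_Idn: "\<lbrakk>A \<in> Obj C; B \<in> Obj C\<rbrakk> \<Longrightarrow> \<ii> A \<otimes> \<ii> B = \<ii> (A \<boxtimes> B)"
    and tensor_Comp:
      "\<lbrakk>A \<in> Obj C; A' \<in> Obj C; A'' \<in> Obj C; B \<in> Obj C; B' \<in> Obj C; B'' \<in> Obj C;
        f \<in> Hom C A A'; f' \<in> Hom C A' A''; g \<in> Hom C B B'; g' \<in> Hom C B' B''\<rbrakk>
       \<Longrightarrow> (f' \<cdot> f) \<otimes> (g' \<cdot> g) = (f' \<otimes> g') \<cdot> (f \<otimes> g)"
    and assoc_iso:
      "\<lbrakk>A \<in> Obj C; B \<in> Obj C; D \<in> Obj C\<rbrakk>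
       \<Longrightarrow> is_iso C ((A \<boxtimes> B) \<boxtimes> D) (A \<boxtimes> (B \<boxtimes> D)) (\<alpha> A B D)"
    and assoc_natural:
      "\<lbrakk>A \<in> Obj C; A' \<in> Obj C; B \<in> Obj C; B' \<in> Obj C; D \<in> Obj C; D' \<in> Obj C;
        f \<in> Hom C A A'; g \<in> Hom C B B'; h \<in> Hom C D D'\<rbrakk>
       \<Longrightarrow> \<alpha> A' B' D' \<cdot> ((f \<otimes> g) \<otimes> h) = (f \<otimes> (g \<otimes> h)) \<cdot> \<alpha> A B D"
    and lunit_iso: "A \<in> Obj C \<Longrightarrow> is_iso C (\<one> \<boxtimes> A) A (\<ll> A)"
    and lunit_natural:
      "\<lbrakk>A \<in> Obj C; A' \<in> Obj C; f \<in> Hom C A A'\<rbrakk> \<Longrightarrow> \<ll> A' \<cdot> (\<ii> \<one> \<otimes> f) = f \<cdot> \<ll> A"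
    and runit_iso: "A \<in> Obj C \<Longrightarrow> is_iso C (A \<boxtimes> \<one>) A (\<rr> A)"
    and runit_natural:
      "\<lbrakk>A \<in> Obj C; A' \<in> Obj C; f \<in> Hom C A A'\<rbrakk> \<Longrightarrow> \<rr> A' \<cdot> (f \<otimes> \<ii> \<one>) = f \<cdot> \<rr> A"
    and pentagon:
      "\<lbrakk>A \<in> Obj C; B \<in> Obj C; D \<in> Obj C; E \<in> Obj C\<rbrakk>
       \<Longrightarrow> \<alpha> A B (D \<boxtimes> E) \<cdot> \<alpha> (A \<boxtimes> B) D E
           = (\<ii> A \<otimes> \<alpha> B D E) \<cdot> \<alpha> A (B \<boxtimes> D) E \<cdot> (\<alpha> A B D \<otimes> \<ii> E)"
    and triangle:
      "\<lbrakk>A \<in> Obj C; B \<in> Obj C\<rbrakk> \<Longrightarrow> (\<ii> A \<otimes> \<ll> B) \<cdot> \<alpha> A \<one> B = \<rr> A \<otimes> \<ii> B"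

text \<open>\<open>braid A B : A \<boxtimes> B \<rightarrow> B \<boxtimes> A\<close>, and \<open>braid_inv A B : B \<boxtimes> A \<rightarrow> A \<boxtimes> B\<close> is its inverse
  (not \<open>braid B A\<close>): no symmetry is assumed.\<close>

record ('o, 'm) braided = "('o, 'm) monoidal" +
  braid :: "'o \<Rightarrow> 'o \<Rightarrow> 'm"  ("\<cc>\<index>")

context
  fixes C :: "('o, 'm, 'z) braided_scheme" (structure)
begin

definition braid_inv :: "'o \<Rightarrow> 'o \<Rightarrow> 'm" where
  "braid_inv A B = inverse_arrow C (A \<boxtimes> B) (B \<boxtimes> A) (\<cc> A B)"

end

notation braid_inv ("\<cc>''\<index>")

locale braided_monoidal_category =
  monoidal_category C for C :: "('o, 'm, 'z) braided_scheme" (structure) +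
  assumes braid_iso:
      "\<lbrakk>A \<in> Obj C; B \<in> Obj C\<rbrakk> \<Longrightarrow> is_iso C (A \<boxtimes> B) (B \<boxtimes> A) (\<cc> A B)"
    and braid_natural:
      "\<lbrakk>A \<in> Obj C; A' \<in> Obj C; B \<in> Obj C; B' \<in> Obj C; f \<in> Hom C A A'; g \<in> Hom C B B'\<rbrakk>
       \<Longrightarrow> \<cc> A' B' \<cdot> (f \<otimes> g) = (g \<otimes> f) \<cdot> \<cc> A B"
    and hexagon1:
      "\<lbrakk>A \<in> Obj C; B \<in> Obj C; D \<in> Obj C\<rbrakk>
       \<Longrightarrow> \<alpha> B D A \<cdot> \<cc> A (B \<boxtimes> D) \<cdot> \<alpha> A B D
           = (\<ii> B \<otimes> \<cc> A D) \<cdot> \<alpha> B A D \<cdot> (\<cc> A B \<otimes> \<ii> D)"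
    and hexagon2:
      "\<lbrakk>A \<in> Obj C; B \<in> Obj C; D \<in> Obj C\<rbrakk>
       \<Longrightarrow> \<alpha>' D A B \<cdot> \<cc> (A \<boxtimes> B) D \<cdot> \<alpha>' A B D
           = (\<cc> A D \<otimes> \<ii> B) \<cdot> \<alpha>' A D B \<cdot> (\<ii> A \<otimes> \<cc> B D)"


section \<open>Hopf algebras and their duals\<close>

record ('o, 'm) hopf =
  carrier  :: "'o"
  mult     :: "'m"
  one      :: "'m"
  comult   :: "'m"
  counit   :: "'m"
  antipode :: "'m"

context
  fixes C :: "('o, 'm, 'z) braided_scheme" (structure)
begin

text \<open>\<open>\<ii> A \<otimes> \<cc> B D \<otimes> \<ii> E : (A \<boxtimes> B) \<boxtimes> (D \<boxtimes> E) \<rightarrow> (A \<boxtimes> D) \<boxtimes> (B \<boxtimes> E)\<close>\<close>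

definition interchange :: "'o \<Rightarrow> 'o \<Rightarrow> 'o \<Rightarrow> 'o \<Rightarrow> 'm" where
  "interchange A B D E =
     \<alpha>' A D (B \<boxtimes> E)
     \<cdot> (\<ii> A \<otimes> (\<alpha> D B E \<cdot> (\<cc> B D \<otimes> \<ii> E) \<cdot> \<alpha>' B D E))
     \<cdot> \<alpha> A B (D \<boxtimes> E)"

definition hopf_algebra :: "('o, 'm) hopf \<Rightarrow> bool" where
  "hopf_algebra H \<longleftrightarrow>
     (let X = carrier H; \<mu> = mult H; \<eta> = one H; \<Delta> = comult H; \<epsilon> = counit H; S = antipode H in
        X \<in> Obj C
      \<and> \<mu> \<in> Hom C (X \<boxtimes> X) X \<and> \<eta> \<in> Hom C \<one> X
      \<and> \<mu> \<cdot> (\<mu> \<otimes> \<ii> X) = \<mu> \<cdot> (\<ii> X \<otimes> \<mu>) \<cdot> \<alpha> X X X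
      \<and> \<mu> \<cdot> (\<eta> \<otimes> \<ii> X) = \<ll> X \<and> \<mu> \<cdot> (\<ii> X \<otimes> \<eta>) = \<rr> X
      \<and> \<Delta> \<in> Hom C X (X \<boxtimes> X) \<and> \<epsilon> \<in> Hom C X \<one>
      \<and> \<alpha> X X X \<cdot> (\<Delta> \<otimes> \<ii> X) \<cdot> \<Delta> = (\<ii> X \<otimes> \<Delta>) \<cdot> \<Delta>
      \<and> \<ll> X \<cdot> (\<epsilon> \<otimes> \<ii> X) \<cdot> \<Delta> = \<ii> X \<and> \<rr> X \<cdot> (\<ii> X \<otimes> \<epsilon>) \<cdot> \<Delta> = \<ii> X
      \<and> \<Delta> \<cdot> \<mu> = (\<mu> \<otimes> \<mu>) \<cdot> interchange X X X X \<cdot> (\<Delta> \<otimes> \<Delta>)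
      \<and> \<Delta> \<cdot> \<eta> = (\<eta> \<otimes> \<eta>) \<cdot> \<ll>' \<one>
      \<and> \<epsilon> \<cdot> \<mu> = \<ll> \<one> \<cdot> (\<epsilon> \<otimes> \<epsilon>)
      \<and> \<epsilon> \<cdot> \<eta> = \<ii> \<one>
      \<and> S \<in> Hom C X X
      \<and> \<mu> \<cdot> (S \<otimes> \<ii> X) \<cdot> \<Delta> = \<eta> \<cdot> \<epsilon>
      \<and> \<mu> \<cdot> (\<ii> X \<otimes> S) \<cdot> \<Delta> = \<eta> \<cdot> \<epsilon>)"

text \<open>\<open>ev : X \<boxtimes> X\<^sup>* \<rightarrow> \<one>\<close> and \<open>coev : \<one> \<rightarrow> X\<^sup>* \<boxtimes> X\<close> subject to the two zigzag identities.\<close>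

definition duality :: "'o \<Rightarrow> 'o \<Rightarrow> 'm \<Rightarrow> 'm \<Rightarrow> bool" where
  "duality X Xd ev coev \<longleftrightarrow>
     X \<in> Obj C \<and> Xd \<in> Obj C \<and> ev \<in> Hom C (X \<boxtimes> Xd) \<one> \<and> coev \<in> Hom C \<one> (Xd \<boxtimes> X)
     \<and> \<ll> X \<cdot> (ev \<otimes> \<ii> X) \<cdot> \<alpha>' X Xd X \<cdot> (\<ii> X \<otimes> coev) \<cdot> \<rr>' X = \<ii> X
     \<and> \<rr> Xd \<cdot> (\<ii> Xd \<otimes> ev) \<cdot> \<alpha> Xd X Xd \<cdot> (coev \<otimes> \<ii> Xd) \<cdot> \<ll>' Xd = \<ii> Xd"

text \<open>The nested pairing \<open>(X \<boxtimes> X) \<boxtimes> (X\<^sup>* \<boxtimes> X\<^sup>*) \<rightarrow> \<one>\<close>: the inner two factors are paired first.\<close>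

definition nested_pairing :: "'o \<Rightarrow> 'o \<Rightarrow> 'm \<Rightarrow> 'm" where
  "nested_pairing X Xd ev =
     ev \<cdot> (\<ii> X \<otimes> (\<ll> Xd \<cdot> (ev \<otimes> \<ii> Xd) \<cdot> \<alpha>' X Xd Xd)) \<cdot> \<alpha> X X (Xd \<boxtimes> Xd)"

text \<open>\<open>K\<close> is the dual Hopf algebra of \<open>H\<close>: its structure maps are the transposes of those of \<open>H\<close>.
  By non-degeneracy of the pairings the equations below determine them.\<close>

definition dual_hopf_algebra ::
  "('o, 'm) hopf \<Rightarrow> ('o, 'm) hopf \<Rightarrow> 'm \<Rightarrow> 'm \<Rightarrow> bool" where
  "dual_hopf_algebra H K ev coev \<longleftrightarrow>
     hopf_algebra K \<and>
     (let X = carrier H; Xd = carrier K; ev2 = nested_pairing X Xd ev in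
        duality X Xd ev coev
      \<and> ev \<cdot> (\<ii> X \<otimes> mult K) = ev2 \<cdot> (comult H \<otimes> \<ii> (Xd \<boxtimes> Xd))
      \<and> ev \<cdot> (\<ii> X \<otimes> one K) = counit H \<cdot> \<rr> X
      \<and> ev2 \<cdot> (\<ii> (X \<boxtimes> X) \<otimes> comult K) = ev \<cdot> (mult H \<otimes> \<ii> Xd)
      \<and> counit K \<cdot> \<ll> Xd = ev \<cdot> (one H \<otimes> \<ii> Xd)
      \<and> ev \<cdot> (\<ii> X \<otimes> antipode K) = ev \<cdot> (antipode H \<otimes> \<ii> Xd))"

end


section \<open>Modules and Yetter-Drinfeld modules\<close>

record ('o, 'm) lmod =
  ob  :: "'o"
  act :: "'m"

text \<open>\<open>lmod.truncate\<close> is the functor forgetting the coaction.\<close>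

record ('o, 'm) ydmod = "('o, 'm) lmod" +
  coact :: "'m"

context
  fixes C :: "('o, 'm, 'z) braided_scheme" (structure)
begin

definition is_module :: "('o, 'm) hopf \<Rightarrow> 'o \<Rightarrow> 'm \<Rightarrow> bool" where
  "is_module H V r \<longleftrightarrow>
     (let X = carrier H in
        V \<in> Obj C \<and> r \<in> Hom C (X \<boxtimes> V) V
      \<and> r \<cdot> (mult H \<otimes> \<ii> V) = r \<cdot> (\<ii> X \<otimes> r) \<cdot> \<alpha> X X V
      \<and> r \<cdot> (one H \<otimes> \<ii> V) = \<ll> V)"

definition is_comodule :: "('o, 'm) hopf \<Rightarrow> 'o \<Rightarrow> 'm \<Rightarrow> bool" where
  "is_comodule H V d \<longleftrightarrow>
     (let X = carrier H in
        V \<in> Obj C \<and> d \<in> Hom C V (X \<boxtimes> V)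
      \<and> \<alpha> X X V \<cdot> (comult H \<otimes> \<ii> V) \<cdot> d = (\<ii> X \<otimes> d) \<cdot> d
      \<and> \<ll> V \<cdot> (counit H \<otimes> \<ii> V) \<cdot> d = \<ii> V)"

definition tensor_act :: "('o, 'm) hopf \<Rightarrow> ('o, 'm) lmod \<Rightarrow> ('o, 'm) lmod \<Rightarrow> 'm" where
  "tensor_act H V W =
     (act V \<otimes> act W)
     \<cdot> interchange C (carrier H) (carrier H) (ob V) (ob W)
     \<cdot> (comult H \<otimes> \<ii> (ob V \<boxtimes> ob W))"

text \<open>The monoidal category \<open>X-mod\<close>; its arrows are arrows of \<open>\<X>\<close>.\<close>

definition Mod :: "('o, 'm) hopf \<Rightarrow> (('o, 'm) lmod, 'm) monoidal" where
  "Mod H = \<lparr>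
     Obj = {V. is_module H (ob V) (act V)},
     Hom = (\<lambda>V W. {f \<in> Hom C (ob V) (ob W). f \<cdot> act V = act W \<cdot> (\<ii> (carrier H) \<otimes> f)}),
     Idn = (\<lambda>V. \<ii> (ob V)),
     Comp = (\<cdot>),
     tensor_ob = (\<lambda>V W. \<lparr>ob = ob V \<boxtimes> ob W, act = tensor_act H V W\<rparr>),
     tensor = (\<otimes>),
     unit_ob = \<lparr>ob = \<one>, act = \<ll> \<one> \<cdot> (counit H \<otimes> \<ii> \<one>)\<rparr>,
     assoc = (\<lambda>V W U. \<alpha> (ob V) (ob W) (ob U)),
     lunit = (\<lambda>V. \<ll> (ob V)),
     runit = (\<lambda>V. \<rr> (ob V))\<rparr>"

text \<open>Left-left Yetter-Drinfeld compatibility of an action \<open>r\<close> and a coaction \<open>d\<close> on \<open>Z\<close>;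
  it says that \<open>half_braiding\<close> below is \<open>X\<close>-linear.\<close>

definition yd_condition :: "('o, 'm) hopf \<Rightarrow> 'o \<Rightarrow> 'm \<Rightarrow> 'm \<Rightarrow> bool" where
  "yd_condition H Z r d \<longleftrightarrow>
     (let X = carrier H in
        (mult H \<otimes> r) \<cdot> interchange C X X X Z \<cdot> (comult H \<otimes> d)
        = (mult H \<otimes> \<ii> Z) \<cdot> \<alpha>' X X Z \<cdot> (\<ii> X \<otimes> \<cc> Z X) \<cdot> \<alpha> X Z X
          \<cdot> ((d \<cdot> r) \<otimes> \<ii> X)
          \<cdot> \<alpha>' X Z X \<cdot> (\<ii> X \<otimes> \<cc> X Z) \<cdot> \<alpha> X X Z \<cdot> (comult H \<otimes> \<ii> Z))"

text \<open>The category \<open>DX-mod\<close>.\<close>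

definition YD :: "('o, 'm) hopf \<Rightarrow> (('o, 'm) ydmod, 'm) category" where
  "YD H = \<lparr>
     Obj = {Z. is_module H (ob Z) (act Z) \<and> is_comodule H (ob Z) (coact Z)
               \<and> yd_condition H (ob Z) (act Z) (coact Z)},
     Hom = (\<lambda>Z Z'. {f \<in> Hom C (ob Z) (ob Z').
               f \<cdot> act Z = act Z' \<cdot> (\<ii> (carrier H) \<otimes> f)
             \<and> (\<ii> (carrier H) \<otimes> f) \<cdot> coact Z = coact Z' \<cdot> f}),
     Idn = (\<lambda>Z. \<ii> (ob Z)),
     Comp = (\<cdot>)\<rparr>"

text \<open>\<open>\<tau>\<^sub>Z\<^sub>,\<^sub>V : Z \<boxtimes> V \<rightarrow> V \<boxtimes> Z\<close>\<close>

definition half_braiding :: "('o, 'm) hopf \<Rightarrow> ('o, 'm) ydmod \<Rightarrow> ('o, 'm) lmod \<Rightarrow> 'm" where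
  "half_braiding H Z V =
     (let X = carrier H in
        (act V \<otimes> \<ii> (ob Z))
        \<cdot> \<alpha>' X (ob V) (ob Z)
        \<cdot> (\<ii> X \<otimes> \<cc> (ob Z) (ob V))
        \<cdot> \<alpha> X (ob Z) (ob V)
        \<cdot> (coact Z \<otimes> \<ii> (ob V)))"

end


section \<open>The equivalence \<open>\<Omega>\<close>\<close>

context
  fixes C :: "('o, 'm, 'z) braided_scheme" (structure)
    and H K :: "('o, 'm) hopf"
    and ev coev :: "'m"
begin

text \<open>\<open>\<Omega>\<close> on objects; on arrows it is the identity.\<close>

definition Omega :: "('o, 'm) ydmod \<Rightarrow> ('o, 'm) ydmod" where
  "Omega Z =
     (let X = carrier H; Xd = carrier K; M = ob Z in
      \<lparr>ob = M,
       act =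
         \<rr> M
         \<cdot> (\<ii> M \<otimes> ev)
         \<cdot> \<alpha> M X Xd
         \<cdot> (\<cc>' M X \<otimes> \<ii> Xd)
         \<cdot> (coact Z \<otimes> \<ii> Xd)
         \<cdot> \<cc> Xd M,
       coact =
         (\<ii> Xd \<otimes> act Z)
         \<cdot> \<alpha> Xd X M
         \<cdot> (coev \<otimes> \<ii> M)
         \<cdot> \<ll>' M\<rparr>)"

text \<open>The \<open>X\<close>-coaction \<open>\<delta>\<^sub>W : W \<rightarrow> X \<boxtimes> W\<close> of an \<open>X\<^sup>*\<close>-module \<open>W\<close>.\<close>

definition dual_coact :: "('o, 'm) lmod \<Rightarrow> 'm" where
  "dual_coact W =
     (let X = carrier H; Xd = carrier K in
        \<cc> (ob W) X
        \<cdot> (act W \<otimes> \<ii> X)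
        \<cdot> (\<cc>' Xd (ob W) \<otimes> \<ii> X)
        \<cdot> \<alpha>' (ob W) Xd X
        \<cdot> (\<ii> (ob W) \<otimes> coev)
        \<cdot> \<rr>' (ob W))"

text \<open>\<open>a\<^sub>V\<^sub>,\<^sub>M\<^sub>,\<^sub>W : (V \<boxtimes> M) \<boxtimes> W \<rightarrow> V \<boxtimes> (M \<boxtimes> W)\<close>\<close>

definition mid_constraint :: "('o, 'm) lmod \<Rightarrow> 'o \<Rightarrow> ('o, 'm) lmod \<Rightarrow> 'm" where
  "mid_constraint V M W =
     (let X = carrier H in
        \<alpha> (ob V) M (ob W)
        \<cdot> ((act V \<otimes> \<ii> M) \<otimes> \<ii> (ob W))
        \<cdot> (\<alpha>' X (ob V) M \<otimes> \<ii> (ob W))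
        \<cdot> (\<cc>' X (ob V \<boxtimes> M) \<otimes> \<ii> (ob W))
        \<cdot> \<alpha>' (ob V \<boxtimes> M) X (ob W)
        \<cdot> (\<ii> (ob V \<boxtimes> M) \<otimes> dual_coact W))"

end


section \<open>Bimodule categories\<close>

text \<open>
  An \<open>L\<close>-\<open>R\<close>-bimodule category, with constraints
  \<open>(V \<otimes> V').M \<rightarrow> V.(V'.M)\<close>, \<open>\<one>.M \<rightarrow> M\<close>, \<open>M.(W \<otimes> W') \<rightarrow> (M.W).W'\<close>, \<open>M.\<one> \<rightarrow> M\<close> and
  \<open>(V.M).W \<rightarrow> V.(M.W)\<close>.
\<close>

record ('o, 'm, 'v, 'p, 'w, 'q) bimod = "('o, 'm) category" +
  lact_ob :: "'v \<Rightarrow> 'o \<Rightarrow> 'o"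
  lact    :: "'p \<Rightarrow> 'm \<Rightarrow> 'm"
  lassoc  :: "'v \<Rightarrow> 'v \<Rightarrow> 'o \<Rightarrow> 'm"
  lmunit  :: "'o \<Rightarrow> 'm"
  ract_ob :: "'o \<Rightarrow> 'w \<Rightarrow> 'o"
  ract    :: "'m \<Rightarrow> 'q \<Rightarrow> 'm"
  rassoc  :: "'o \<Rightarrow> 'w \<Rightarrow> 'w \<Rightarrow> 'm"
  rmunit  :: "'o \<Rightarrow> 'm"
  mid     :: "'v \<Rightarrow> 'o \<Rightarrow> 'w \<Rightarrow> 'm"

locale bimodule_category =
  L: monoidal_category L + R: monoidal_category R + M: category M
  for L :: "('v, 'p) monoidal" and R :: "('w, 'q) monoidal"
    and M :: "('o, 'm, 'v, 'p, 'w, 'q) bimod" (structure) +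
  assumes lact_ob_in_Obj: "\<lbrakk>V \<in> Obj L; A \<in> Obj M\<rbrakk> \<Longrightarrow> lact_ob M V A \<in> Obj M"
    and lact_in_Hom:
      "\<lbrakk>V \<in> Obj L; V' \<in> Obj L; A \<in> Obj M; A' \<in> Obj M; p \<in> Hom L V V'; f \<in> Hom M A A'\<rbrakk>
       \<Longrightarrow> lact M p f \<in> Hom M (lact_ob M V A) (lact_ob M V' A')"
    and lact_Idn:
      "\<lbrakk>V \<in> Obj L; A \<in> Obj M\<rbrakk> \<Longrightarrow> lact M (Idn L V) (\<ii> A) = \<ii> (lact_ob M V A)"
    and lact_Comp:
      "\<lbrakk>V \<in> Obj L; V' \<in> Obj L; V'' \<in> Obj L; A \<in> Obj M; A' \<in> Obj M; A'' \<in> Obj M;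
        p \<in> Hom L V V'; p' \<in> Hom L V' V''; f \<in> Hom M A A'; f' \<in> Hom M A' A''\<rbrakk>
       \<Longrightarrow> lact M (Comp L p' p) (f' \<cdot> f) = lact M p' f' \<cdot> lact M p f"
    and lassoc_iso:
      "\<lbrakk>V \<in> Obj L; V' \<in> Obj L; A \<in> Obj M\<rbrakk>
       \<Longrightarrow> is_iso M (lact_ob M (tensor_ob L V V') A) (lact_ob M V (lact_ob M V' A)) (lassoc M V V' A)"
    and lassoc_natural:
      "\<lbrakk>V \<in> Obj L; V1 \<in> Obj L; V' \<in> Obj L; V1' \<in> Obj L; A \<in> Obj M; A1 \<in> Obj M;
        p \<in> Hom L V V1; p' \<in> Hom L V' V1'; f \<in> Hom M A A1\<rbrakk>
       \<Longrightarrow> lassoc M V1 V1' A1 \<cdot> lact M (tensor L p p') f = lact M p (lact M p' f) \<cdot> lassoc M V V' A"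
    and lassoc_pentagon:
      "\<lbrakk>V \<in> Obj L; V' \<in> Obj L; V'' \<in> Obj L; A \<in> Obj M\<rbrakk>
       \<Longrightarrow> lassoc M V V' (lact_ob M V'' A) \<cdot> lassoc M (tensor_ob L V V') V'' A
           = lact M (Idn L V) (lassoc M V' V'' A) \<cdot> lassoc M V (tensor_ob L V' V'') A
             \<cdot> lact M (assoc L V V' V'') (\<ii> A)"
    and lmunit_iso: "A \<in> Obj M \<Longrightarrow> is_iso M (lact_ob M (unit_ob L) A) A (lmunit M A)"
    and lmunit_natural:
      "\<lbrakk>A \<in> Obj M; A' \<in> Obj M; f \<in> Hom M A A'\<rbrakk>
       \<Longrightarrow> lmunit M A' \<cdot> lact M (Idn L (unit_ob L)) f = f \<cdot> lmunit M A"
    and lmunit_triangle: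
      "\<lbrakk>V \<in> Obj L; A \<in> Obj M\<rbrakk>
       \<Longrightarrow> lact M (Idn L V) (lmunit M A) \<cdot> lassoc M V (unit_ob L) A = lact M (runit L V) (\<ii> A)"
    and ract_ob_in_Obj: "\<lbrakk>A \<in> Obj M; W \<in> Obj R\<rbrakk> \<Longrightarrow> ract_ob M A W \<in> Obj M"
    and ract_in_Hom:
      "\<lbrakk>A \<in> Obj M; A' \<in> Obj M; W \<in> Obj R; W' \<in> Obj R; f \<in> Hom M A A'; q \<in> Hom R W W'\<rbrakk>
       \<Longrightarrow> ract M f q \<in> Hom M (ract_ob M A W) (ract_ob M A' W')"
    and ract_Idn:
      "\<lbrakk>A \<in> Obj M; W \<in> Obj R\<rbrakk> \<Longrightarrow> ract M (\<ii> A) (Idn R W) = \<ii> (ract_ob M A W)"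
    and ract_Comp:
      "\<lbrakk>A \<in> Obj M; A' \<in> Obj M; A'' \<in> Obj M; W \<in> Obj R; W' \<in> Obj R; W'' \<in> Obj R;
        f \<in> Hom M A A'; f' \<in> Hom M A' A''; q \<in> Hom R W W'; q' \<in> Hom R W' W''\<rbrakk>
       \<Longrightarrow> ract M (f' \<cdot> f) (Comp R q' q) = ract M f' q' \<cdot> ract M f q"
    and rassoc_iso:
      "\<lbrakk>A \<in> Obj M; W \<in> Obj R; W' \<in> Obj R\<rbrakk>
       \<Longrightarrow> is_iso M (ract_ob M A (tensor_ob R W W')) (ract_ob M (ract_ob M A W) W') (rassoc M A W W')"
    and rassoc_natural:
      "\<lbrakk>A \<in> Obj M; A1 \<in> Obj M; W \<in> Obj R; W1 \<in> Obj R; W' \<in> Obj R; W1' \<in> Obj R;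
        f \<in> Hom M A A1; q \<in> Hom R W W1; q' \<in> Hom R W' W1'\<rbrakk>
       \<Longrightarrow> rassoc M A1 W1 W1' \<cdot> ract M f (tensor R q q') = ract M (ract M f q) q' \<cdot> rassoc M A W W'"
    and rassoc_pentagon:
      "\<lbrakk>A \<in> Obj M; W \<in> Obj R; W' \<in> Obj R; W'' \<in> Obj R\<rbrakk>
       \<Longrightarrow> rassoc M (ract_ob M A W) W' W'' \<cdot> rassoc M A W (tensor_ob R W' W'')
             \<cdot> ract M (\<ii> A) (assoc R W W' W'')
           = ract M (rassoc M A W W') (Idn R W'') \<cdot> rassoc M A (tensor_ob R W W') W''"
    and rmunit_iso: "A \<in> Obj M \<Longrightarrow> is_iso M (ract_ob M A (unit_ob R)) A (rmunit M A)"
    and rmunit_natural: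
      "\<lbrakk>A \<in> Obj M; A' \<in> Obj M; f \<in> Hom M A A'\<rbrakk>
       \<Longrightarrow> rmunit M A' \<cdot> ract M f (Idn R (unit_ob R)) = f \<cdot> rmunit M A"
    and rmunit_triangle:
      "\<lbrakk>A \<in> Obj M; W \<in> Obj R\<rbrakk>
       \<Longrightarrow> ract M (rmunit M A) (Idn R W) \<cdot> rassoc M A (unit_ob R) W = ract M (\<ii> A) (lunit R W)"
    and mid_iso:
      "\<lbrakk>V \<in> Obj L; A \<in> Obj M; W \<in> Obj R\<rbrakk>
       \<Longrightarrow> is_iso M (ract_ob M (lact_ob M V A) W) (lact_ob M V (ract_ob M A W)) (mid M V A W)"
    and mid_natural:
      "\<lbrakk>V \<in> Obj L; V' \<in> Obj L; A \<in> Obj M; A' \<in> Obj M; W \<in> Obj R; W' \<in> Obj R;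
        p \<in> Hom L V V'; f \<in> Hom M A A'; q \<in> Hom R W W'\<rbrakk>
       \<Longrightarrow> mid M V' A' W' \<cdot> ract M (lact M p f) q = lact M p (ract M f q) \<cdot> mid M V A W"
    and mid_left_pentagon:
      "\<lbrakk>V \<in> Obj L; V' \<in> Obj L; A \<in> Obj M; W \<in> Obj R\<rbrakk>
       \<Longrightarrow> lassoc M V V' (ract_ob M A W) \<cdot> mid M (tensor_ob L V V') A W
           = lact M (Idn L V) (mid M V' A W) \<cdot> mid M V (lact_ob M V' A) W
             \<cdot> ract M (lassoc M V V' A) (Idn R W)"
    and mid_right_pentagon:
      "\<lbrakk>V \<in> Obj L; A \<in> Obj M; W \<in> Obj R; W' \<in> Obj R\<rbrakk>
       \<Longrightarrow> lact M (Idn L V) (rassoc M A W W') \<cdot> mid M V A (tensor_ob R W W')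
           = mid M V (ract_ob M A W) W' \<cdot> ract M (mid M V A W) (Idn R W')
             \<cdot> rassoc M (lact_ob M V A) W W'"

text \<open>
  The data of \<open>\<M>\<close>, with underlying category \<open>\<X>\<close>.  That these data satisfy
  \<open>bimodule_category\<close> is a condition on \<open>X\<close> and the braiding: \<open>mid_right_pentagon\<close>
  at \<open>V = X\<close>, \<open>A = \<one>\<close>, \<open>W = X\<^sup>*\<close> and \<open>W'\<close> any object \<open>U\<close> with the trivial action amounts to
  \<open>\<cc> U X \<cdot> \<cc> X U = \<ii> (X \<boxtimes> U)\<close>.
\<close>

context
  fixes C :: "('o, 'm) braided" (structure)
    and H K :: "('o, 'm) hopf"
    and coev :: "'m"
begin

definition bimod_M ::
  "('o, 'm, ('o, 'm) lmod, 'm, ('o, 'm) lmod, 'm) bimod" where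
  "bimod_M = \<lparr>
     Obj = Obj C,
     Hom = Hom C,
     Idn = \<ii>,
     Comp = (\<cdot>),
     lact_ob = (\<lambda>V A. ob V \<boxtimes> A),
     lact = (\<otimes>),
     lassoc = (\<lambda>V V' A. \<alpha> (ob V) (ob V') A),
     lmunit = \<ll>,
     ract_ob = (\<lambda>A W. A \<boxtimes> ob W),
     ract = (\<otimes>),
     rassoc = (\<lambda>A W W'. \<alpha>' A (ob W) (ob W')),
     rmunit = \<rr>,
     mid = mid_constraint C H K coev\<rparr>"

end

end

(*
The isomorphism psi is the braiding c_{Z,M} of the ambient category.  Part (i) is naturality of c
with respect to the coaction of Z: the inverse braiding in a_{V,M,Omega(Z)} cancels the strand of X
that naturality pulls across V (x) M, once the zigzag identity has identified the X-coaction of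
Omega(Z) with that of Z.  Part (ii) also needs X to be transparent, which the right pentagon of the
bimodule category forces.

To avoid associators, an arrow f : a -> b between bracketed words is replaced by the family of
arrows a.N -> b.N in which the word acts on N by nested tensoring (A (x) B).N = A (x) (B (x) N).
This is Cayley's strictification: it is faithful, and associators and unitors become identities.
*)

theory Submission
  imports Defs
begin

section \<open>Arrows with endpoints\<close>

text \<open>In (ii) the strand of \<open>X\<close> issuing from \<open>W\<close> crosses
  \<open>Z\<close>, \<open>M\<close> and \<open>W\<close> by inverse braidings in
  \<open>mid_constraint\<close> but by a positive one in \<open>dual_coact\<close>, so the two sides
  agree only up to double braidings with \<open>X\<close>. These are trivial because of the trivial
  modules: tensoring \<open>W\<close> with a trivial \<open>U\<close> leaves the action of
  \<open>W\<close> alone, and the coaction of \<open>U\<close> is the unit of \<open>X\<close>, so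
  the only trace of \<open>U\<close> in the right pentagon is its crossing with \<open>X\<close>.

  In (i) the crossings cancel by themselves; the obstacle there is that the inverse of
  \<open>a\<close> is a definite description, meaningful only once \<open>a\<close> is known to be
  invertible. The bimodule axioms grant this for objects of \<open>Mod C K\<close>, so
  \<open>Omega\<close> has to be shown to produce modules.

  Words form a datatype because an object of \<open>C\<close> does not remember how it was built
  from factors.\<close>

datatype 'o bracketing =
    BUnit
  | BAtom 'o ("\<langle>_\<rangle>")
  | BProd "'o bracketing" "'o bracketing" (infixr "\<odot>" 70)

text \<open>Hom sets may overlap.  Recording the endpoints makes the side conditions of the category laws
  computable by the simplifier.\<close>

datatype ('a, 'm) tarr = TArr (src: 'a) (arr: 'm) (tgt: 'a)

context category
begin

definition arrow :: "('o, 'm) tarr \<Rightarrow> bool" where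
  "arrow f \<longleftrightarrow> src f \<in> Obj C \<and> tgt f \<in> Obj C \<and> arr f \<in> Hom C (src f) (tgt f)"

text \<open>The type of endpoints is left open, so one composition serves both objects of
  \<open>C\<close> and, later, bracketed words. That endpoints match is not built in; it reappears
  as a premise of the laws.\<close>

definition tcomp :: "('a, 'm) tarr \<Rightarrow> ('a, 'm) tarr \<Rightarrow> ('a, 'm) tarr" (infixr "\<star>" 55) where
  "g \<star> f = TArr (src f) (arr g \<cdot> arr f) (tgt g)"

definition tid :: "'o \<Rightarrow> ('o, 'm) tarr" where
  "tid A = TArr A (\<ii> A) A"

definition tinv :: "('o, 'm) tarr \<Rightarrow> ('o, 'm) tarr" where
  "tinv f = TArr (tgt f) (inverse_arrow C (src f) (tgt f) (arr f)) (src f)"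

definition iso :: "('o, 'm) tarr \<Rightarrow> bool" where
  "iso f \<longleftrightarrow> src f \<in> Obj C \<and> tgt f \<in> Obj C \<and> is_iso C (src f) (tgt f) (arr f)"

lemma src_tcomp [simp]: "src (g \<star> f) = src f"
  and tgt_tcomp [simp]: "tgt (g \<star> f) = tgt g"
  and arr_tcomp [simp]: "arr (g \<star> f) = arr g \<cdot> arr f"
  by (simp_all add: tcomp_def)

lemma src_tid [simp]: "src (tid A) = A"
  and tgt_tid [simp]: "tgt (tid A) = A"
  and src_tinv [simp]: "src (tinv f) = tgt f"
  and tgt_tinv [simp]: "tgt (tinv f) = src f"
  by (simp_all add: tid_def tinv_def)

lemma arrow_src [simp]: "arrow f \<Longrightarrow> src f \<in> Obj C"
  and arrow_tgt [simp]: "arrow f \<Longrightarrow> tgt f \<in> Obj C"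
  by (simp_all add: arrow_def)

lemmas arrow_Obj = arrow_src arrow_tgt

lemma arrow_tid [simp]: "A \<in> Obj C \<Longrightarrow> arrow (tid A)"
  by (simp add: arrow_def tid_def Idn_in_Hom del: arrow_Obj)

lemma arrow_tcomp [simp]: "\<lbrakk>arrow f; arrow g; tgt f = src g\<rbrakk> \<Longrightarrow> arrow (g \<star> f)"
  unfolding arrow_def by (auto simp del: arrow_Obj intro: Comp_in_Hom)

lemma tcomp_assoc [simp]:
  "\<lbrakk>arrow f; arrow g; arrow h; tgt f = src g; tgt g = src h\<rbrakk> \<Longrightarrow> (h \<star> g) \<star> f = h \<star> g \<star> f"
  unfolding arrow_def tcomp_def by (auto simp del: arrow_Obj intro: Comp_assoc)

lemma tcomp_tid [simp]: "\<lbrakk>arrow f; src f = A\<rbrakk> \<Longrightarrow> f \<star> tid A = f"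
  by (cases f) (auto simp: arrow_def tcomp_def tid_def simp del: arrow_Obj intro: Comp_Idn)

lemma tid_tcomp [simp]: "\<lbrakk>arrow f; tgt f = A\<rbrakk> \<Longrightarrow> tid A \<star> f = f"
  by (cases f) (auto simp: arrow_def tcomp_def tid_def simp del: arrow_Obj intro: Idn_Comp)

lemma tarr_eqI: "\<lbrakk>src f = src g; tgt f = tgt g; arr f = arr g\<rbrakk> \<Longrightarrow> f = g"
  by (cases f, cases g) simp

lemma inverse_arrows_unique:
  assumes "A \<in> Obj C" "B \<in> Obj C" "inverse_arrows C A B f g" "inverse_arrows C A B f h"
  shows "g = h"
proof -
  have "g = g \<cdot> (f \<cdot> h)" using assms by (simp add: inverse_arrows_def Comp_Idn)
  also have "\<dots> = (g \<cdot> f) \<cdot> h"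
    using assms Comp_assoc [of B A B A h f g] by (simp add: inverse_arrows_def)
  also have "\<dots> = h" using assms by (simp add: inverse_arrows_def Idn_Comp)
  finally show ?thesis .
qed

lemma inverse_arrow_eq:
  assumes "A \<in> Obj C" "B \<in> Obj C" "inverse_arrows C A B f g"
  shows "inverse_arrow C A B f = g"
  unfolding inverse_arrow_def using assms inverse_arrows_unique by blast

lemma inverse_arrows_inverse_arrow:
  assumes "A \<in> Obj C" "B \<in> Obj C" "is_iso C A B f"
  shows "inverse_arrows C A B f (inverse_arrow C A B f)"
  using assms inverse_arrow_eq unfolding is_iso_def by metis

lemma iso_arrow [simp]: "iso f \<Longrightarrow> arrow f"
  by (auto simp: arrow_def iso_def is_iso_def inverse_arrows_def simp del: arrow_Obj)

lemma arrow_tinv [simp]: "iso f \<Longrightarrow> arrow (tinv f)"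
  and tinv_tcomp [simp]: "iso f \<Longrightarrow> tinv f \<star> f = tid (src f)"
  and tcomp_tinv [simp]: "iso f \<Longrightarrow> f \<star> tinv f = tid (tgt f)"
  using inverse_arrows_inverse_arrow [of "src f" "tgt f" "arr f"]
  by (auto simp: iso_def arrow_def tinv_def tcomp_def tid_def inverse_arrows_def simp del: arrow_Obj)

text \<open>Used in two ways: to prove an arrow invertible by exhibiting its inverse, and to compute
  \<open>tinv\<close>, which rests on a definite description.\<close>

lemma tinv_unique:
  assumes "arrow f" "arrow g" "src g = tgt f" "tgt g = src f"
    and "g \<star> f = tid (src f)" "f \<star> g = tid (tgt f)"
  shows "iso f" "tinv f = g"
proof -
  have 1: "inverse_arrows C (src f) (tgt f) (arr f) (arr g)"
    using assms unfolding arrow_def inverse_arrows_def tcomp_def tid_def by (auto simp del: arrow_Obj)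
  then show "iso f" using assms(1) by (auto simp: iso_def is_iso_def arrow_def simp del: arrow_Obj)
  show "tinv f = g"
    using inverse_arrow_eq [OF _ _ 1] assms by (cases g) (simp add: tinv_def arrow_def del: arrow_Obj)
qed

lemma tinv_tcomp_left [simp]:
  "\<lbrakk>iso f; arrow h; tgt h = src f\<rbrakk> \<Longrightarrow> tinv f \<star> f \<star> h = h"
  using tcomp_assoc [of h f "tinv f"] by simp

lemma tcomp_tinv_left [simp]:
  "\<lbrakk>iso f; arrow h; tgt h = tgt f\<rbrakk> \<Longrightarrow> f \<star> tinv f \<star> h = h"
  using tcomp_assoc [of h "tinv f" f] by simp

lemma iso_tid [simp]: "A \<in> Obj C \<Longrightarrow> iso (tid A)"
  by (rule tinv_unique [of "tid A" "tid A"]) auto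

lemma iso_tcomp [simp]: "\<lbrakk>iso f; iso g; tgt f = src g\<rbrakk> \<Longrightarrow> iso (g \<star> f)"
  by (rule tinv_unique [of _ "tinv f \<star> tinv g"]) auto

lemma iso_tinv [simp]: "iso f \<Longrightarrow> iso (tinv f)"
  by (rule tinv_unique [of _ f]) auto

lemma iso_cancel_left:
  assumes "f \<star> g = f \<star> h" "iso f" "arrow g" "arrow h" "tgt g = src f" "tgt h = src f"
  shows "g = h"
proof -
  have "g = tinv f \<star> f \<star> g" using assms(2-) by simp
  also have "\<dots> = h" unfolding assms(1) using assms(2-) by simp
  finally show ?thesis .
qed

lemma iso_cancel_right:
  assumes "g \<star> f = h \<star> f" "iso f" "arrow g" "arrow h" "src g = tgt f" "src h = tgt f"
  shows "g = h"
proof -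
  have "g = (g \<star> f) \<star> tinv f" using assms(2-) by simp
  also have "\<dots> = h" unfolding assms(1) using assms(2-) by simp
  finally show ?thesis .
qed

text \<open>Composites are kept nested to the right, so an equation for \<open>g \<star> f\<close>
  does not match inside a longer composite. Resolving it with this rule gives the version with a
  tail \<open>h\<close>, which is the form handed to the simplifier below.\<close>

lemma tcomp_left_cong:
  "\<lbrakk>g \<star> f = k; arrow f; arrow g; tgt f = src g; arrow h; tgt h = src f\<rbrakk> \<Longrightarrow> g \<star> f \<star> h = k \<star> h"
  using tcomp_assoc by metis

lemma tinv_tcomp_eq: "\<lbrakk>f \<star> g = h; iso f; arrow g; tgt g = src f\<rbrakk> \<Longrightarrow> tinv f \<star> h = g"
  by auto

lemma tinv_tcomp_distrib:
  "\<lbrakk>iso f; iso g; tgt f = src g\<rbrakk> \<Longrightarrow> tinv (g \<star> f) = tinv f \<star> tinv g"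
  by (rule tinv_unique) auto

lemma tinv_tid [simp]: "A \<in> Obj C \<Longrightarrow> tinv (tid A) = tid A"
  by (rule tinv_unique) auto

text \<open>This will show that braiding with the unit object is trivial.\<close>

lemma iso_idem:
  assumes "iso f" "src f = tgt f" "f \<star> f = f" shows "f = tid (src f)"
  by (rule iso_cancel_left [of f]) (use assms in auto)

text \<open>Inverting two opposite sides of a commuting square is how naturality of the braiding
  becomes naturality of its inverse.\<close>

lemma tinv_square:
  assumes "b \<star> f = f' \<star> b'" "iso b" "iso b'" "arrow f" "arrow f'"
    and "tgt f = src b" "src f = src b'" "src f' = tgt b'" "tgt f' = tgt b"
  shows "f \<star> tinv b' = tinv b \<star> f'"
proof (rule iso_cancel_left [of b])
  have "b \<star> f \<star> tinv b' = (b \<star> f) \<star> tinv b'" using assms(2-) by simp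
  also have "\<dots> = f'" unfolding assms(1) using assms(2-) by simp
  finally show "b \<star> f \<star> tinv b' = b \<star> tinv b \<star> f'" using assms(2-) by simp
qed (use assms in auto)

text \<open>Stated for bare arrows because condition (i) of the theorem is: there the inverse of
  \<open>a\<close> stands on the right, while the proof works with \<open>a\<close> on the
  left.\<close>

lemma eq_inverse_arrow_Comp:
  assumes iso: "is_iso C A B f" and x: "x \<in> Hom C D A" and eq: "f \<cdot> x = y"
    and Obj: "A \<in> Obj C" "B \<in> Obj C" "D \<in> Obj C"
  shows "x = inverse_arrow C A B f \<cdot> y"
proof -
  have inv: "inverse_arrows C A B f (inverse_arrow C A B f)"
    using Obj(1,2) iso by (rule inverse_arrows_inverse_arrow)
  then have "inverse_arrow C A B f \<cdot> f \<cdot> x = (inverse_arrow C A B f \<cdot> f) \<cdot> x"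
    using Obj x Comp_assoc [of D A B A x f "inverse_arrow C A B f"] by (simp add: inverse_arrows_def)
  then show ?thesis using inv Obj x eq by (simp add: inverse_arrows_def Idn_Comp)
qed

end

section \<open>Whiskering, and the coherence laws for arrows with endpoints\<close>

context monoidal_category
begin

lemmas Obj_intros [simp] = unit_ob_in_Obj tensor_ob_in_Obj

text \<open>Kept apart from \<open>\<bullet>\<close>, although it is tensoring with an identity:
  being a functor of one variable, it can be distributed over composites by the simplifier, which
  gives normal forms made of whiskered generators.\<close>

definition whisk :: "'o \<Rightarrow> ('o, 'm) tarr \<Rightarrow> ('o, 'm) tarr" (infixr "\<rhd>" 60) where
  "A \<rhd> f = TArr (A \<boxtimes> src f) (\<ii> A \<otimes> arr f) (A \<boxtimes> tgt f)"

definition ttensor :: "('o, 'm) tarr \<Rightarrow> ('o, 'm) tarr \<Rightarrow> ('o, 'm) tarr" (infixr "\<bullet>" 70) where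
  "f \<bullet> g = TArr (src f \<boxtimes> src g) (arr f \<otimes> arr g) (tgt f \<boxtimes> tgt g)"

definition tassoc where "tassoc A B D = TArr ((A \<boxtimes> B) \<boxtimes> D) (\<alpha> A B D) (A \<boxtimes> B \<boxtimes> D)"
definition tlunit where "tlunit A = TArr (\<one> \<boxtimes> A) (\<ll> A) A"
definition trunit where "trunit A = TArr (A \<boxtimes> \<one>) (\<rr> A) A"

lemma src_whisk [simp]: "src (A \<rhd> f) = A \<boxtimes> src f"
  and tgt_whisk [simp]: "tgt (A \<rhd> f) = A \<boxtimes> tgt f"
  and src_ttensor [simp]: "src (f \<bullet> g) = src f \<boxtimes> src g"
  and tgt_ttensor [simp]: "tgt (f \<bullet> g) = tgt f \<boxtimes> tgt g"
  and src_tassoc [simp]: "src (tassoc A B D) = (A \<boxtimes> B) \<boxtimes> D"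
  and tgt_tassoc [simp]: "tgt (tassoc A B D) = A \<boxtimes> B \<boxtimes> D"
  and src_tlunit [simp]: "src (tlunit A) = \<one> \<boxtimes> A"
  and tgt_tlunit [simp]: "tgt (tlunit A) = A"
  and src_trunit [simp]: "src (trunit A) = A \<boxtimes> \<one>"
  and tgt_trunit [simp]: "tgt (trunit A) = A"
  by (simp_all add: whisk_def ttensor_def tassoc_def tlunit_def trunit_def)

lemma arrow_ttensor [simp]: "\<lbrakk>arrow f; arrow g\<rbrakk> \<Longrightarrow> arrow (f \<bullet> g)"
  by (auto simp: arrow_def ttensor_def simp del: arrow_Obj intro: tensor_in_Hom)

lemma whisk_ttensor: "A \<rhd> f = tid A \<bullet> f"
  by (simp add: whisk_def ttensor_def tid_def)

lemma arrow_whisk [simp]: "\<lbrakk>A \<in> Obj C; arrow f\<rbrakk> \<Longrightarrow> arrow (A \<rhd> f)"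
  by (simp add: whisk_ttensor)

lemma ttensor_tid [simp]: "\<lbrakk>A \<in> Obj C; B \<in> Obj C\<rbrakk> \<Longrightarrow> tid A \<bullet> tid B = tid (A \<boxtimes> B)"
  by (simp add: ttensor_def tid_def tensor_Idn)

lemma ttensor_tcomp:
  "\<lbrakk>arrow f; arrow f'; arrow g; arrow g'; tgt f = src f'; tgt g = src g'\<rbrakk>
   \<Longrightarrow> (f' \<star> f) \<bullet> (g' \<star> g) = (f' \<bullet> g') \<star> (f \<bullet> g)"
  using tensor_Comp [of "src f" "tgt f" "tgt f'" "src g" "tgt g" "tgt g'" "arr f" "arr f'" "arr g" "arr g'"]
  by (simp add: arrow_def ttensor_def tcomp_def del: arrow_Obj)

lemma whisk_tid [simp]: "\<lbrakk>A \<in> Obj C; B \<in> Obj C\<rbrakk> \<Longrightarrow> A \<rhd> tid B = tid (A \<boxtimes> B)"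
  by (simp add: whisk_ttensor)

lemma whisk_tcomp [simp]:
  "\<lbrakk>A \<in> Obj C; arrow f; arrow g; tgt f = src g\<rbrakk> \<Longrightarrow> A \<rhd> (g \<star> f) = (A \<rhd> g) \<star> (A \<rhd> f)"
  using ttensor_tcomp [of "tid A" "tid A" f g] by (simp add: whisk_ttensor)

lemma iso_ttensor [simp]:
  assumes "iso f" "iso g" shows "iso (f \<bullet> g)"
  by (rule tinv_unique [of _ "tinv f \<bullet> tinv g"])
    (use assms ttensor_tcomp [of f "tinv f" g "tinv g"] ttensor_tcomp [of "tinv f" f "tinv g" g]
      in simp_all)

lemma iso_whisk [simp]: "\<lbrakk>A \<in> Obj C; iso f\<rbrakk> \<Longrightarrow> iso (A \<rhd> f)"
  by (simp add: whisk_ttensor)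

lemma tinv_whisk: "\<lbrakk>A \<in> Obj C; iso f\<rbrakk> \<Longrightarrow> tinv (A \<rhd> f) = A \<rhd> tinv f"
  by (rule tinv_unique)
    (use whisk_tcomp [of A f "tinv f"] whisk_tcomp [of A "tinv f" f] in simp_all)

lemma iso_tassoc [simp]: "\<lbrakk>A \<in> Obj C; B \<in> Obj C; D \<in> Obj C\<rbrakk> \<Longrightarrow> iso (tassoc A B D)"
  and iso_tlunit [simp]: "A \<in> Obj C \<Longrightarrow> iso (tlunit A)"
  and iso_trunit [simp]: "A \<in> Obj C \<Longrightarrow> iso (trunit A)"
  by (simp_all add: iso_def tassoc_def tlunit_def trunit_def assoc_iso lunit_iso runit_iso)

lemma tassoc_natural:
  "\<lbrakk>arrow f; arrow g; arrow h\<rbrakk>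
   \<Longrightarrow> tassoc (tgt f) (tgt g) (tgt h) \<star> ((f \<bullet> g) \<bullet> h)
       = (f \<bullet> g \<bullet> h) \<star> tassoc (src f) (src g) (src h)"
  by (auto simp: arrow_def tassoc_def ttensor_def tcomp_def simp del: arrow_Obj intro: assoc_natural)

lemma tlunit_natural: "arrow f \<Longrightarrow> tlunit (tgt f) \<star> (\<one> \<rhd> f) = f \<star> tlunit (src f)"
  by (cases f) (auto simp: arrow_def tlunit_def whisk_def tcomp_def simp del: arrow_Obj intro: lunit_natural)

lemma trunit_natural: "arrow f \<Longrightarrow> trunit (tgt f) \<star> (f \<bullet> tid \<one>) = f \<star> trunit (src f)"
  by (cases f) (auto simp: arrow_def trunit_def ttensor_def tid_def tcomp_def simp del: arrow_Obj
      intro: runit_natural)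

lemma tpentagon:
  "\<lbrakk>A \<in> Obj C; B \<in> Obj C; D \<in> Obj C; E \<in> Obj C\<rbrakk>
   \<Longrightarrow> tassoc A B (D \<boxtimes> E) \<star> tassoc (A \<boxtimes> B) D E
       = (A \<rhd> tassoc B D E) \<star> tassoc A (B \<boxtimes> D) E \<star> (tassoc A B D \<bullet> tid E)"
  by (simp add: tassoc_def whisk_def ttensor_def tid_def tcomp_def pentagon)

lemma ttriangle:
  "\<lbrakk>A \<in> Obj C; B \<in> Obj C\<rbrakk> \<Longrightarrow> (A \<rhd> tlunit B) \<star> tassoc A \<one> B = trunit A \<bullet> tid B"
  by (simp add: tassoc_def whisk_def ttensor_def tid_def tcomp_def tlunit_def trunit_def triangle)

text \<open>\<open>tlunit\<close> is natural and invertible, so tensoring with the unit object is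
  faithful. The triangle only yields left unitors that are already tensored on the left; this
  removes that factor.\<close>

lemma whisk_unit_cancel:
  assumes "\<one> \<rhd> f = \<one> \<rhd> g" "arrow f" "arrow g" "src f = src g" "tgt f = tgt g"
  shows "f = g"
proof -
  have "f \<star> tlunit (src f) = g \<star> tlunit (src f)"
    using tlunit_natural [OF assms(2)] tlunit_natural [OF assms(3)] assms(1,4,5) by simp
  then show ?thesis by (rule iso_cancel_right) (use assms in auto)
qed

lemma rwhisk_tcomp:
  "\<lbrakk>B \<in> Obj C; arrow f; arrow g; tgt f = src g\<rbrakk> \<Longrightarrow> (g \<star> f) \<bullet> tid B = (g \<bullet> tid B) \<star> (f \<bullet> tid B)"
  using ttensor_tcomp [of f g "tid B" "tid B"] by simp

text \<open>Kelly's consequence of the pentagon and the triangle.\<close>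

lemma tlunit_tassoc:
  assumes "A \<in> Obj C" "B \<in> Obj C"
  shows "tlunit (A \<boxtimes> B) \<star> tassoc \<one> A B = tlunit A \<bullet> tid B"
proof (rule whisk_unit_cancel)
  \<comment> \<open>\<open>?a\<close> is the part of the pentagon for unit, unit, \<open>A\<close>,
    \<open>B\<close> that is cancelled on the right at the end.\<close>
  let ?a = "tassoc \<one> (\<one> \<boxtimes> A) B \<star> (tassoc \<one> \<one> A \<bullet> tid B)"
  have "(\<one> \<rhd> (tlunit (A \<boxtimes> B) \<star> tassoc \<one> A B)) \<star> ?a
      = (\<one> \<rhd> tlunit (A \<boxtimes> B)) \<star> tassoc \<one> \<one> (A \<boxtimes> B) \<star> tassoc (\<one> \<boxtimes> \<one>) A B"
    using assms by (simp add: tpentagon)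
  also have "\<dots> = ((\<one> \<rhd> tlunit (A \<boxtimes> B)) \<star> tassoc \<one> \<one> (A \<boxtimes> B)) \<star> tassoc (\<one> \<boxtimes> \<one>) A B"
    using assms by simp
  also have "\<dots> = (trunit \<one> \<bullet> tid A \<bullet> tid B) \<star> tassoc (\<one> \<boxtimes> \<one>) A B"
    using assms by (simp add: ttriangle)
  also have "\<dots> = tassoc \<one> A B \<star> ((trunit \<one> \<bullet> tid A) \<bullet> tid B)"
    using assms tassoc_natural [of "trunit \<one>" "tid A" "tid B"] by simp
  also have "\<dots> = tassoc \<one> A B \<star> (((\<one> \<rhd> tlunit A) \<star> tassoc \<one> \<one> A) \<bullet> tid B)"
    using assms by (simp add: ttriangle)
  also have "\<dots> = (tassoc \<one> A B \<star> ((tid \<one> \<bullet> tlunit A) \<bullet> tid B)) \<star> (tassoc \<one> \<one> A \<bullet> tid B)"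
    using assms by (simp add: rwhisk_tcomp whisk_ttensor)
  also have "\<dots> = (\<one> \<rhd> (tlunit A \<bullet> tid B)) \<star> ?a"
    using assms tassoc_natural [of "tid \<one>" "tlunit A" "tid B"] by (simp add: whisk_ttensor)
  finally show "\<one> \<rhd> (tlunit (A \<boxtimes> B) \<star> tassoc \<one> A B) = \<one> \<rhd> (tlunit A \<bullet> tid B)"
    by (rule iso_cancel_right) (use assms in auto)
qed (use assms in auto)

section \<open>Strictification\<close>

primrec val :: "'o bracketing \<Rightarrow> 'o" where
  "val BUnit = \<one>"
| "val \<langle>A\<rangle> = A"
| "val (a \<odot> b) = val a \<boxtimes> val b"

primrec wf :: "'o bracketing \<Rightarrow> bool" where
  "wf BUnit = True"
| "wf \<langle>A\<rangle> = (A \<in> Obj C)"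
| "wf (a \<odot> b) = (wf a \<and> wf b)"

text \<open>The Cayley action of a word. \<open>BUnit\<close> acts as the identity, unlike the atom
  of the unit object, and the brackets disappear.\<close>

primrec app :: "'o bracketing \<Rightarrow> 'o \<Rightarrow> 'o" where
  "app BUnit N = N"
| "app \<langle>A\<rangle> N = A \<boxtimes> N"
| "app (a \<odot> b) N = app a (app b N)"

primrec whisks :: "'o bracketing \<Rightarrow> ('o, 'm) tarr \<Rightarrow> ('o, 'm) tarr" where
  "whisks BUnit h = h"
| "whisks \<langle>A\<rangle> h = A \<rhd> h"
| "whisks (a \<odot> b) h = whisks a (whisks b h)"

text \<open>The canonical comparison between tensoring with the value of a word and letting the word
  act, made of associators and left unitors.\<close>

primrec flat :: "'o bracketing \<Rightarrow> 'o \<Rightarrow> ('o, 'm) tarr" where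
  "flat BUnit N = tlunit N"
| "flat \<langle>A\<rangle> N = tid (A \<boxtimes> N)"
| "flat (a \<odot> b) N = whisks a (flat b N) \<star> flat a (val b \<boxtimes> N) \<star> tassoc (val a) (val b) N"

lemma val_Obj [simp]: "wf a \<Longrightarrow> val a \<in> Obj C"
  by (induction a) auto

lemma app_Obj [simp]: "\<lbrakk>wf a; N \<in> Obj C\<rbrakk> \<Longrightarrow> app a N \<in> Obj C"
  by (induction a arbitrary: N) auto

lemma src_whisks [simp]: "src (whisks a h) = app a (src h)"
  and tgt_whisks [simp]: "tgt (whisks a h) = app a (tgt h)"
  by (induction a arbitrary: h) auto

lemma arrow_whisks [simp]: "\<lbrakk>wf a; arrow h\<rbrakk> \<Longrightarrow> arrow (whisks a h)"
  by (induction a arbitrary: h) auto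

lemma iso_whisks [simp]: "\<lbrakk>wf a; iso h\<rbrakk> \<Longrightarrow> iso (whisks a h)"
  by (induction a arbitrary: h) auto

lemma whisks_tid [simp]: "\<lbrakk>wf a; N \<in> Obj C\<rbrakk> \<Longrightarrow> whisks a (tid N) = tid (app a N)"
  by (induction a arbitrary: N) auto

lemma whisks_tcomp:
  "\<lbrakk>wf a; arrow f; arrow g; tgt f = src g\<rbrakk> \<Longrightarrow> whisks a (g \<star> f) = whisks a g \<star> whisks a f"
  by (induction a arbitrary: f g) auto

lemma src_flat [simp]: "src (flat a N) = val a \<boxtimes> N"
  by (cases a) auto

lemma tgt_flat [simp]: "tgt (flat a N) = app a N"
  by (induction a arbitrary: N) auto

lemma iso_flat [simp]: "\<lbrakk>wf a; N \<in> Obj C\<rbrakk> \<Longrightarrow> iso (flat a N)"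
  by (induction a arbitrary: N) auto

text \<open>For a product the square is pasted from three: the one for \<open>b\<close> under
  \<open>whisks a\<close>, the one for \<open>a\<close> at \<open>val b \<rhd> h\<close>, and
  naturality of the associator.\<close>

lemma flat_natural:
  "\<lbrakk>wf a; arrow h\<rbrakk> \<Longrightarrow> whisks a h \<star> flat a (src h) = flat a (tgt h) \<star> (val a \<rhd> h)"
proof (induction a arbitrary: h)
  case BUnit
  then show ?case by (simp add: tlunit_natural)
next
  case (BProd a b)
  let ?v = "val a" and ?w = "val b"
  note wf = BProd.prems
  have "whisks (a \<odot> b) h \<star> flat (a \<odot> b) (src h)
      = (whisks a (whisks b h) \<star> whisks a (flat b (src h))) \<star> flat a (?w \<boxtimes> src h) \<star> tassoc ?v ?w (src h)"
    using wf by simp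
  also have "whisks a (whisks b h) \<star> whisks a (flat b (src h)) = whisks a (flat b (tgt h)) \<star> whisks a (?w \<rhd> h)"
    using wf BProd.IH(2) [of h] whisks_tcomp [of a "flat b (src h)" "whisks b h"]
      whisks_tcomp [of a "?w \<rhd> h" "flat b (tgt h)"] by simp
  also have "(\<dots>) \<star> flat a (?w \<boxtimes> src h) \<star> tassoc ?v ?w (src h)
      = whisks a (flat b (tgt h)) \<star> (whisks a (?w \<rhd> h) \<star> flat a (?w \<boxtimes> src h)) \<star> tassoc ?v ?w (src h)"
    using wf by simp
  also have "whisks a (?w \<rhd> h) \<star> flat a (?w \<boxtimes> src h) = flat a (?w \<boxtimes> tgt h) \<star> (?v \<rhd> ?w \<rhd> h)"
    using wf BProd.IH(1) [of "?w \<rhd> h"] by simp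
  also have "whisks a (flat b (tgt h)) \<star> (\<dots>) \<star> tassoc ?v ?w (src h)
      = whisks a (flat b (tgt h)) \<star> flat a (?w \<boxtimes> tgt h) \<star> (?v \<rhd> ?w \<rhd> h) \<star> tassoc ?v ?w (src h)"
    using wf by simp
  also have "(?v \<rhd> ?w \<rhd> h) \<star> tassoc ?v ?w (src h) = tassoc ?v ?w (tgt h) \<star> (?v \<boxtimes> ?w \<rhd> h)"
    using wf tassoc_natural [of "tid ?v" "tid ?w" h] by (simp add: whisk_ttensor)
  finally show ?case using wf by simp
qed simp

section \<open>Arrows between bracketed words and their strict images\<close>

definition underlying :: "('o bracketing, 'm) tarr \<Rightarrow> ('o, 'm) tarr" where
  "underlying f = TArr (val (src f)) (arr f) (val (tgt f))"

definition barrow :: "('o bracketing, 'm) tarr \<Rightarrow> bool" where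
  "barrow f \<longleftrightarrow> wf (src f) \<and> wf (tgt f) \<and> arr f \<in> Hom C (val (src f)) (val (tgt f))"

definition biso :: "('o bracketing, 'm) tarr \<Rightarrow> bool" where
  "biso f \<longleftrightarrow> wf (src f) \<and> wf (tgt f) \<and> is_iso C (val (src f)) (val (tgt f)) (arr f)"

definition btensor ::
  "('o bracketing, 'm) tarr \<Rightarrow> ('o bracketing, 'm) tarr \<Rightarrow> ('o bracketing, 'm) tarr"
  (infixr "\<uplus>" 70) where
  "f \<uplus> g = TArr (src f \<odot> src g) (arr f \<otimes> arr g) (tgt f \<odot> tgt g)"

definition bid where "bid a = TArr a (\<ii> (val a)) a"
definition bassoc where
  "bassoc a b d = TArr ((a \<odot> b) \<odot> d) (\<alpha> (val a) (val b) (val d)) (a \<odot> b \<odot> d)"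
definition blunit where "blunit a = TArr (BUnit \<odot> a) (\<ll> (val a)) a"
definition brunit where "brunit a = TArr (a \<odot> BUnit) (\<rr> (val a)) a"
definition binv where
  "binv f = TArr (tgt f) (inverse_arrow C (val (src f)) (val (tgt f)) (arr f)) (src f)"

lemmas bdefs = btensor_def bid_def bassoc_def blunit_def brunit_def binv_def tcomp_def
  assoc_inv_def lunit_inv_def runit_inv_def

lemma src_tgt_bracketed [simp]:
  "src (f \<uplus> g) = src f \<odot> src g" "tgt (f \<uplus> g) = tgt f \<odot> tgt g"
  "src (bid a) = a" "tgt (bid a) = a"
  "src (bassoc a b d) = (a \<odot> b) \<odot> d" "tgt (bassoc a b d) = a \<odot> b \<odot> d"
  "src (blunit a) = BUnit \<odot> a" "tgt (blunit a) = a"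
  "src (brunit a) = a \<odot> BUnit" "tgt (brunit a) = a"
  "src (binv f) = tgt f" "tgt (binv f) = src f"
  by (simp_all add: bdefs)

lemma barrow_wf [simp]: "barrow f \<Longrightarrow> wf (src f)" "barrow f \<Longrightarrow> wf (tgt f)"
  by (simp_all add: barrow_def)

lemma src_underlying [simp]: "src (underlying f) = val (src f)"
  and tgt_underlying [simp]: "tgt (underlying f) = val (tgt f)"
  by (simp_all add: underlying_def)

lemma barrow_iff: "barrow f \<longleftrightarrow> wf (src f) \<and> wf (tgt f) \<and> arrow (underlying f)"
  by (auto simp: barrow_def arrow_def underlying_def simp del: arrow_Obj barrow_wf)

lemma biso_iff: "biso f \<longleftrightarrow> wf (src f) \<and> wf (tgt f) \<and> iso (underlying f)"
  by (auto simp: biso_def iso_def underlying_def)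

lemma arrow_underlying [simp]: "barrow f \<Longrightarrow> arrow (underlying f)"
  using barrow_iff by blast

lemma underlying_simps:
  "underlying (g \<star> f) = underlying g \<star> underlying f"
  "underlying (f \<uplus> g) = underlying f \<bullet> underlying g"
  "underlying (bid a) = tid (val a)"
  "underlying (bassoc a b d) = tassoc (val a) (val b) (val d)" "underlying (blunit a) = tlunit (val a)"
  "underlying (brunit a) = trunit (val a)" "underlying (binv f) = tinv (underlying f)"
  by (simp_all add: underlying_def bdefs ttensor_def tid_def tassoc_def tlunit_def trunit_def tinv_def)

lemma biso_barrow [simp]: "biso f \<Longrightarrow> barrow f"
  by (simp add: barrow_iff biso_iff del: barrow_wf arrow_underlying)

lemma barrow_intros [simp]:
  "\<lbrakk>barrow f; barrow g; tgt f = src g\<rbrakk> \<Longrightarrow> barrow (g \<star> f)"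
  "\<lbrakk>barrow f; barrow g\<rbrakk> \<Longrightarrow> barrow (f \<uplus> g)"
  "wf a \<Longrightarrow> barrow (bid a)"
  "biso f \<Longrightarrow> barrow (binv f)"
  by (simp_all add: barrow_iff biso_iff underlying_simps del: barrow_wf arrow_underlying)

lemma biso_intros [simp]:
  "\<lbrakk>wf a; wf b; wf d\<rbrakk> \<Longrightarrow> biso (bassoc a b d)"
  "wf a \<Longrightarrow> biso (blunit a)"
  "wf a \<Longrightarrow> biso (brunit a)"
  "wf a \<Longrightarrow> biso (bid a)"
  "biso f \<Longrightarrow> biso (binv f)"
  "\<lbrakk>biso f; biso g\<rbrakk> \<Longrightarrow> biso (f \<uplus> g)"
  "\<lbrakk>biso f; biso g; tgt f = src g\<rbrakk> \<Longrightarrow> biso (g \<star> f)"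
  by (simp_all add: biso_iff underlying_simps del: barrow_wf)

text \<open>The strict image of \<open>f\<close>: tensoring \<open>f\<close> with \<open>N\<close>,
  conjugated by the comparison isomorphisms.\<close>

definition Hat :: "('o bracketing, 'm) tarr \<Rightarrow> 'o \<Rightarrow> ('o, 'm) tarr" where
  "Hat f N = flat (tgt f) N \<star> (underlying f \<bullet> tid N) \<star> tinv (flat (src f) N)"

lemma src_Hat [simp]: "src (Hat f N) = app (src f) N"
  and tgt_Hat [simp]: "tgt (Hat f N) = app (tgt f) N"
  by (simp_all add: Hat_def)

lemma arrow_Hat [simp]: "\<lbrakk>barrow f; N \<in> Obj C\<rbrakk> \<Longrightarrow> arrow (Hat f N)"
  by (simp add: Hat_def)

lemma iso_Hat [simp]: "\<lbrakk>biso f; N \<in> Obj C\<rbrakk> \<Longrightarrow> iso (Hat f N)"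
  by (simp add: Hat_def biso_iff del: barrow_wf biso_barrow)

text \<open>\<open>flat\<close> is invertible, so a commuting square determines
  \<open>Hat f N\<close>; working with the square avoids the inverse in the definition.\<close>

lemma Hat_eqI:
  assumes "h \<star> flat (src f) N = flat (tgt f) N \<star> (underlying f \<bullet> tid N)"
    and "barrow f" "arrow h" "N \<in> Obj C" "src h = app (src f) N" "tgt h = app (tgt f) N"
  shows "Hat f N = h"
proof (rule iso_cancel_right)
  show "Hat f N \<star> flat (src f) N = h \<star> flat (src f) N"
    unfolding assms(1) Hat_def using assms(2-) by simp
qed (use assms in auto)

lemma Hat_flat:
  "\<lbrakk>barrow f; N \<in> Obj C\<rbrakk> \<Longrightarrow> Hat f N \<star> flat (src f) N = flat (tgt f) N \<star> (underlying f \<bullet> tid N)"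
  by (simp add: Hat_def)

text \<open>The interchange law in strict form: \<open>f\<close> acts on the strands to the left and
  \<open>h\<close> on those to the right, so their order does not matter.\<close>

lemma Hat_natural:
  assumes "barrow f" "arrow h"
  shows "Hat f (tgt h) \<star> whisks (src f) h = whisks (tgt f) h \<star> Hat f (src h)"
proof (rule iso_cancel_right)
  have [simp]: "wf (src f)" "wf (tgt f)" using assms by auto
  let ?s = "flat (src f)" and ?t = "flat (tgt f)"
  have "(Hat f (tgt h) \<star> whisks (src f) h) \<star> ?s (src h) = (Hat f (tgt h) \<star> ?s (tgt h)) \<star> (val (src f) \<rhd> h)"
    using assms by (simp add: flat_natural)
  also have "\<dots> = ?t (tgt h) \<star> (underlying f \<bullet> tid (tgt h)) \<star> (tid (val (src f)) \<bullet> h)"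
    unfolding Hat_flat [OF assms(1) arrow_tgt [OF assms(2)]] using assms by (simp add: whisk_ttensor)
  also have "(underlying f \<bullet> tid (tgt h)) \<star> (tid (val (src f)) \<bullet> h)
      = (tid (val (tgt f)) \<bullet> h) \<star> (underlying f \<bullet> tid (src h))"
    using assms by (simp flip: ttensor_tcomp)
  also have "?t (tgt h) \<star> (\<dots>) = (?t (tgt h) \<star> (val (tgt f) \<rhd> h)) \<star> (underlying f \<bullet> tid (src h))"
    using assms by (simp add: whisk_ttensor)
  also have "\<dots> = whisks (tgt f) h \<star> Hat f (src h) \<star> ?s (src h)"
    using assms by (simp add: Hat_flat flip: flat_natural)
  finally show "(Hat f (tgt h) \<star> whisks (src f) h) \<star> ?s (src h) = (whisks (tgt f) h \<star> Hat f (src h)) \<star> ?s (src h)"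
    using assms by simp
qed (use assms in auto)

lemma Hat_tcomp:
  assumes "barrow f" "barrow g" "tgt f = src g" "N \<in> Obj C"
  shows "Hat (g \<star> f) N = Hat g N \<star> Hat f N"
proof (rule Hat_eqI)
  have "(Hat g N \<star> Hat f N) \<star> flat (src f) N = Hat g N \<star> Hat f N \<star> flat (src f) N"
    using assms by simp
  also have "\<dots> = (Hat g N \<star> flat (src g) N) \<star> (underlying f \<bullet> tid N)"
    using assms by (simp add: Hat_flat [of f])
  also have "\<dots> = flat (tgt g) N \<star> (underlying g \<star> underlying f) \<bullet> tid N"
    unfolding Hat_flat [OF assms(2,4)] using assms by (simp add: rwhisk_tcomp)
  finally show "(Hat g N \<star> Hat f N) \<star> flat (src (g \<star> f)) N = flat (tgt (g \<star> f)) N \<star> (underlying (g \<star> f) \<bullet> tid N)"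
    by (simp add: underlying_simps)
qed (use assms in auto)

lemma Hat_bid [simp]: "\<lbrakk>wf a; N \<in> Obj C\<rbrakk> \<Longrightarrow> Hat (bid a) N = tid (app a N)"
  by (rule Hat_eqI) (auto simp: underlying_simps)

text \<open>The required square is Kelly's identity \<open>tlunit_tassoc\<close>.\<close>

lemma Hat_blunit [simp]: "\<lbrakk>wf a; N \<in> Obj C\<rbrakk> \<Longrightarrow> Hat (blunit a) N = tid (app a N)"
  by (rule Hat_eqI) (simp_all add: underlying_simps tlunit_tassoc)

text \<open>Moving \<open>tlunit N\<close> across \<open>flat a\<close> by naturality turns the
  square into the triangle axiom.\<close>

lemma Hat_brunit [simp]: "\<lbrakk>wf a; N \<in> Obj C\<rbrakk> \<Longrightarrow> Hat (brunit a) N = tid (app a N)"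
proof (rule Hat_eqI)
  assume a: "wf a" "N \<in> Obj C"
  have "flat (a \<odot> BUnit) N = flat a N \<star> (val a \<rhd> tlunit N) \<star> tassoc (val a) \<one> N"
    using a flat_natural [of a "tlunit N"]
    by (simp flip: tcomp_assoc)
  then show "tid (app a N) \<star> flat (src (brunit a)) N = flat (tgt (brunit a)) N \<star> underlying (brunit a) \<bullet> tid N"
    using a by (simp add: underlying_simps ttriangle)
qed auto

text \<open>Once \<open>flat_natural\<close> has moved the inner associator across
  \<open>flat a\<close>, the two sides differ by the pentagon.\<close>

lemma Hat_bassoc [simp]:
  assumes "wf a" "wf b" "wf d" "N \<in> Obj C"
  shows "Hat (bassoc a b d) N = tid (app a (app b (app d N)))"
proof (rule Hat_eqI)
  have "whisks a (flat (b \<odot> d) N) \<star> flat a ((val b \<boxtimes> val d) \<boxtimes> N)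
      = whisks a (whisks b (flat d N)) \<star> whisks a (flat b (val d \<boxtimes> N))
        \<star> whisks a (tassoc (val b) (val d) N) \<star> flat a ((val b \<boxtimes> val d) \<boxtimes> N)"
    using assms by (simp add: whisks_tcomp)
  also have "whisks a (tassoc (val b) (val d) N) \<star> flat a ((val b \<boxtimes> val d) \<boxtimes> N)
      = flat a (val b \<boxtimes> val d \<boxtimes> N) \<star> (val a \<rhd> tassoc (val b) (val d) N)"
    using assms flat_natural [of a "tassoc (val b) (val d) N"] by simp
  finally have "flat (a \<odot> b \<odot> d) N \<star> (tassoc (val a) (val b) (val d) \<bullet> tid N)
      = (whisks a (whisks b (flat d N)) \<star> whisks a (flat b (val d \<boxtimes> N)) \<star> flat a (val b \<boxtimes> val d \<boxtimes> N)
        \<star> (val a \<rhd> tassoc (val b) (val d) N)) \<star> tassoc (val a) (val b \<boxtimes> val d) N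
        \<star> (tassoc (val a) (val b) (val d) \<bullet> tid N)"
    using assms by (simp flip: tcomp_assoc del: tcomp_assoc)
  then show "tid (app a (app b (app d N))) \<star> flat (src (bassoc a b d)) N
      = flat (tgt (bassoc a b d)) N \<star> (underlying (bassoc a b d) \<bullet> tid N)"
    using assms by (simp add: underlying_simps flip: tpentagon)
qed (use assms in auto)

text \<open>In the strict picture a tensor product of arrows is performed one factor at a time.
  Doing the right factor first is a convention that fixes normal forms; \<open>Hat_natural\<close>
  exchanges the two.\<close>

lemma Hat_btensor:
  assumes f: "barrow f" and g: "barrow g" and N: "N \<in> Obj C"
  shows "Hat (f \<uplus> g) N = Hat f (app (tgt g) N) \<star> whisks (src f) (Hat g N)"
proof (rule Hat_eqI)
  have [simp]: "wf (src f)" "wf (tgt f)" "wf (src g)" "wf (tgt g)" using f g by auto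
  let ?s = "src f" and ?t = "tgt f" and ?s' = "src g" and ?t' = "tgt g"
  let ?h = "flat ?t' N \<star> (underlying g \<bullet> tid N)"
  let ?a = "tassoc (val ?s) (val ?s') N"
  have "(Hat f (app ?t' N) \<star> whisks ?s (Hat g N)) \<star> flat (?s \<odot> ?s') N
      = Hat f (app ?t' N) \<star> whisks ?s (Hat g N \<star> flat ?s' N) \<star> flat ?s (val ?s' \<boxtimes> N) \<star> ?a"
    using f g N by (simp add: whisks_tcomp)
  also have "\<dots> = Hat f (app ?t' N) \<star> (whisks ?s ?h \<star> flat ?s (val ?s' \<boxtimes> N)) \<star> ?a"
    unfolding Hat_flat [OF g N] using f g N by simp
  also have "whisks ?s ?h \<star> flat ?s (val ?s' \<boxtimes> N) = flat ?s (app ?t' N) \<star> (val ?s \<rhd> ?h)"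
    using flat_natural [of ?s ?h] f g N by simp
  also have "Hat f (app ?t' N) \<star> (\<dots>) \<star> ?a
      = (Hat f (app ?t' N) \<star> flat ?s (app ?t' N)) \<star> (val ?s \<rhd> ?h) \<star> ?a"
    using f g N by simp
  also have "\<dots> = flat ?t (app ?t' N) \<star> ((underlying f \<bullet> tid (app ?t' N)) \<star> (tid (val ?s) \<bullet> ?h)) \<star> ?a"
    unfolding Hat_flat [OF f app_Obj [OF \<open>wf ?t'\<close> N]] using f g N by (simp add: whisk_ttensor)
  also have "(underlying f \<bullet> tid (app ?t' N)) \<star> (tid (val ?s) \<bullet> ?h)
      = (val ?t \<rhd> flat ?t' N) \<star> (underlying f \<bullet> underlying g \<bullet> tid N)"
    using f g N ttensor_tcomp [of "tid (val ?s)" "underlying f" ?h "tid (app ?t' N)"]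
      ttensor_tcomp [of "underlying f" "tid (val ?t)" "underlying g \<bullet> tid N" "flat ?t' N"]
    by (simp add: whisk_ttensor)
  also have "flat ?t (app ?t' N) \<star> (\<dots>) \<star> ?a
      = (flat ?t (app ?t' N) \<star> (val ?t \<rhd> flat ?t' N)) \<star> (underlying f \<bullet> underlying g \<bullet> tid N) \<star> ?a"
    using f g N by simp
  also have "(underlying f \<bullet> underlying g \<bullet> tid N) \<star> ?a
      = tassoc (val ?t) (val ?t') N \<star> ((underlying f \<bullet> underlying g) \<bullet> tid N)"
    using tassoc_natural [of "underlying f" "underlying g" "tid N"] f g N by simp
  also have "flat ?t (app ?t' N) \<star> (val ?t \<rhd> flat ?t' N) = whisks ?t (flat ?t' N) \<star> flat ?t (val ?t' \<boxtimes> N)"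
    using flat_natural [of ?t "flat ?t' N"] f g N by simp
  finally show "(Hat f (app ?t' N) \<star> whisks ?s (Hat g N)) \<star> flat (src (f \<uplus> g)) N
      = flat (tgt (f \<uplus> g)) N \<star> (underlying (f \<uplus> g) \<bullet> tid N)"
    using f g N by (simp add: underlying_simps)
qed (use assms in auto)

lemma Hat_binv:
  assumes "biso f" "N \<in> Obj C"
  shows "Hat (binv f) N = tinv (Hat f N)"
proof (rule iso_cancel_left)
  have "f \<star> binv f = bid (tgt f)"
    using assms inverse_arrows_inverse_arrow [of "val (src f)" "val (tgt f)" "arr f"]
    by (simp add: biso_def bdefs inverse_arrows_def del: barrow_wf)
  then show "Hat f N \<star> Hat (binv f) N = Hat f N \<star> tinv (Hat f N)"
    using assms Hat_tcomp [of "binv f" f N] by simp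
qed (use assms in auto)

text \<open>One value of \<open>N\<close> suffices: at the unit object \<open>flat\<close> cancels,
  and the right unitor, natural and invertible, removes the spare tensor factor.\<close>

lemma Hat_faithful:
  assumes "Hat f \<one> = Hat g \<one>" "barrow f" "barrow g" "src f = src g" "tgt f = tgt g"
  shows "f = g"
proof -
  have "flat (tgt f) \<one> \<star> (underlying f \<bullet> tid \<one>) = flat (tgt f) \<one> \<star> (underlying g \<bullet> tid \<one>)"
    using Hat_flat [of f \<one>] Hat_flat [of g \<one>] assms by simp
  then have "underlying f \<bullet> tid \<one> = underlying g \<bullet> tid \<one>"
    by (rule iso_cancel_left) (use assms in auto)
  then have "underlying f \<star> trunit (val (src f)) = underlying g \<star> trunit (val (src f))"
    using trunit_natural [of "underlying f"] trunit_natural [of "underlying g"] assms by simp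
  then have "underlying f = underlying g"
    by (rule iso_cancel_right) (use assms in auto)
  then show ?thesis using assms by (cases f, cases g) (simp add: underlying_def)
qed

text \<open>The simplifier splits whiskered composites, so an equation used under a whisker must be
  split as well. Chained with \<open>tcomp_left_cong\<close> this gives rules that apply inside
  longer composites.\<close>

lemma whisk_cong:
  "\<lbrakk>g \<star> f = k; arrow f; arrow g; tgt f = src g; A \<in> Obj C\<rbrakk> \<Longrightarrow> (A \<rhd> g) \<star> (A \<rhd> f) = A \<rhd> k"
  using whisk_tcomp by metis

lemma whisk_tinv_cancel [simp]:
  "\<lbrakk>A \<in> Obj C; iso f\<rbrakk> \<Longrightarrow> (A \<rhd> f) \<star> (A \<rhd> tinv f) = tid (A \<boxtimes> tgt f)"
  "\<lbrakk>A \<in> Obj C; iso f\<rbrakk> \<Longrightarrow> (A \<rhd> tinv f) \<star> (A \<rhd> f) = tid (A \<boxtimes> src f)"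
  "\<lbrakk>A \<in> Obj C; iso f; arrow h; tgt h = A \<boxtimes> tgt f\<rbrakk> \<Longrightarrow> (A \<rhd> f) \<star> (A \<rhd> tinv f) \<star> h = h"
  "\<lbrakk>A \<in> Obj C; iso f; arrow h; tgt h = A \<boxtimes> src f\<rbrakk> \<Longrightarrow> (A \<rhd> tinv f) \<star> (A \<rhd> f) \<star> h = h"
  by (simp_all flip: tinv_whisk)

end

context braided_monoidal_category
begin

section \<open>The braiding\<close>

definition brd :: "'o bracketing \<Rightarrow> 'o bracketing \<Rightarrow> ('o bracketing, 'm) tarr" where
  "brd a b = TArr (a \<odot> b) (\<cc> (val a) (val b)) (b \<odot> a)"

lemma src_brd [simp]: "src (brd a b) = a \<odot> b" and tgt_brd [simp]: "tgt (brd a b) = b \<odot> a"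
  by (simp_all add: brd_def)

lemma biso_brd [simp]: "\<lbrakk>wf a; wf b\<rbrakk> \<Longrightarrow> biso (brd a b)"
  by (simp add: biso_def brd_def braid_iso)

lemma brd_natural:
  "\<lbrakk>barrow f; barrow g\<rbrakk> \<Longrightarrow> brd (tgt f) (tgt g) \<star> (f \<uplus> g) = (g \<uplus> f) \<star> brd (src f) (src g)"
  by (auto simp: barrow_def brd_def bdefs simp del: barrow_wf intro: braid_natural)

lemma Hat_brd_left:
  "\<lbrakk>barrow f; wf d; N \<in> Obj C\<rbrakk>
   \<Longrightarrow> Hat (brd (tgt f) d) N \<star> Hat f (app d N) = whisks d (Hat f N) \<star> Hat (brd (src f) d) N"
  using arg_cong [OF brd_natural [of f "bid d"], of "\<lambda>h. Hat h N"]
  by (simp add: Hat_tcomp Hat_btensor)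

lemma Hat_brd_right:
  "\<lbrakk>barrow f; wf d; N \<in> Obj C\<rbrakk>
   \<Longrightarrow> Hat (brd d (tgt f)) N \<star> whisks d (Hat f N) = Hat f (app d N) \<star> Hat (brd d (src f)) N"
  using arg_cong [OF brd_natural [of "bid d" f], of "\<lambda>h. Hat h N"]
  by (simp add: Hat_tcomp Hat_btensor)

text \<open>The hexagons with their associators erased, here and in the next lemma.\<close>

lemma Hat_brd_tensor_right:
  assumes "wf a" "wf b" "wf d" "N \<in> Obj C"
  shows "Hat (brd a (b \<odot> d)) N = whisks b (Hat (brd a d) N) \<star> Hat (brd a b) (app d N)"
proof -
  have "bassoc b d a \<star> brd a (b \<odot> d) \<star> bassoc a b d
      = (bid b \<uplus> brd a d) \<star> bassoc b a d \<star> (brd a b \<uplus> bid d)"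
    using assms by (simp add: bdefs brd_def hexagon1)
  from arg_cong [OF this, of "\<lambda>h. Hat h N"] show ?thesis
    using assms by (simp add: Hat_tcomp Hat_btensor)
qed

lemma Hat_brd_tensor_left:
  assumes "wf a" "wf b" "wf d" "N \<in> Obj C"
  shows "Hat (brd (a \<odot> b) d) N = Hat (brd a d) (app b N) \<star> whisks a (Hat (brd b d) N)"
proof -
  have "binv (bassoc d a b) \<star> brd (a \<odot> b) d \<star> binv (bassoc a b d)
      = (brd a d \<uplus> bid b) \<star> binv (bassoc a d b) \<star> (bid a \<uplus> brd b d)"
    using assms by (simp add: bdefs brd_def hexagon2 flip: assoc_inv_def)
  from arg_cong [OF this, of "\<lambda>h. Hat h N"] show ?thesis
    using assms by (simp add: Hat_tcomp Hat_btensor Hat_binv)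
qed

text \<open>Naturality for the unitor identifies the braiding of \<open>BUnit \<odot> BUnit\<close>
  with that of \<open>BUnit\<close>, while the hexagon makes it the square of that braiding. An
  idempotent isomorphism is an identity.\<close>

lemma Hat_brd_unit_left [simp]:
  assumes "wf d" "N \<in> Obj C" shows "Hat (brd BUnit d) N = tid (app d N)"
  using iso_idem [of "Hat (brd BUnit d) N"] assms Hat_brd_left [of "blunit BUnit" d N]
    Hat_brd_tensor_left [of BUnit BUnit d N]
  by simp

lemma Hat_brd_unit_right [simp]:
  assumes "wf d" "N \<in> Obj C" shows "Hat (brd d BUnit) N = tid (app d N)"
  using iso_idem [of "Hat (brd d BUnit) N"] assms Hat_brd_right [of "blunit BUnit" d N]
    Hat_brd_tensor_right [of d BUnit BUnit N]
  by simp

definition br :: "'o \<Rightarrow> 'o \<Rightarrow> 'o \<Rightarrow> ('o, 'm) tarr" where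
  "br A B N = Hat (brd \<langle>A\<rangle> \<langle>B\<rangle>) N"

lemma src_br [simp]: "src (br A B N) = A \<boxtimes> B \<boxtimes> N"
  and tgt_br [simp]: "tgt (br A B N) = B \<boxtimes> A \<boxtimes> N"
  and iso_br [simp]: "\<lbrakk>A \<in> Obj C; B \<in> Obj C; N \<in> Obj C\<rbrakk> \<Longrightarrow> iso (br A B N)"
  by (simp_all add: br_def)

text \<open>Oriented so that bracketed arrows unfold into composites of whiskered generators and of
  braidings \<open>br\<close> of two single objects.\<close>

lemmas Hat_simps = Hat_tcomp Hat_btensor Hat_binv Hat_brd_tensor_left Hat_brd_tensor_right
  br_def [symmetric] tinv_tcomp_distrib tinv_whisk

lemma br_slide:
  "\<lbrakk>A \<in> Obj C; B \<in> Obj C; arrow h; tgt h = N\<rbrakk>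
   \<Longrightarrow> br A B N \<star> (A \<rhd> B \<rhd> h) = (B \<rhd> A \<rhd> h) \<star> br A B (src h)"
  using Hat_natural [of "brd \<langle>A\<rangle> \<langle>B\<rangle>" h] by (auto simp: br_def)

lemma tinv_br_slide:
  assumes "A \<in> Obj C" "B \<in> Obj C" "arrow h" "tgt h = N"
  shows "tinv (br A B N) \<star> (B \<rhd> A \<rhd> h) = (A \<rhd> B \<rhd> h) \<star> tinv (br A B (src h))"
proof (rule iso_cancel_left [of "br A B N"])
  show "br A B N \<star> tinv (br A B N) \<star> (B \<rhd> A \<rhd> h)
      = br A B N \<star> (A \<rhd> B \<rhd> h) \<star> tinv (br A B (src h))"
    using assms tcomp_left_cong [OF br_slide [OF assms], of "tinv (br A B (src h))"] by auto
qed (use assms in auto)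

end

section \<open>A Hopf algebra and its dual\<close>

text \<open>The names \<open>b_\<dots>\<close> are the arrows of the statement with bracketed words as endpoints.\<close>

locale hopf_pair = braided_monoidal_category C
  for C :: "('o, 'm) braided" (structure) +
  fixes H K :: "('o, 'm) hopf" and ev coev :: 'm
  assumes hopf: "hopf_algebra C H"
    and dual_hopf: "dual_hopf_algebra C H K ev coev"
begin

abbreviation X where "X \<equiv> carrier H"
abbreviation Xd where "Xd \<equiv> carrier K"

definition "b_ev = TArr (\<langle>X\<rangle> \<odot> \<langle>Xd\<rangle>) ev BUnit"
definition "b_coev = TArr BUnit coev (\<langle>Xd\<rangle> \<odot> \<langle>X\<rangle>)"
definition "b_mult A = TArr (\<langle>carrier A\<rangle> \<odot> \<langle>carrier A\<rangle>) (mult A) \<langle>carrier A\<rangle>"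
definition "b_one A = TArr BUnit (one A) \<langle>carrier A\<rangle>"
definition "b_comult A = TArr \<langle>carrier A\<rangle> (comult A) (\<langle>carrier A\<rangle> \<odot> \<langle>carrier A\<rangle>)"
definition "b_counit A = TArr \<langle>carrier A\<rangle> (counit A) BUnit"

lemmas b_defs = b_ev_def b_coev_def b_mult_def b_one_def b_comult_def b_counit_def

lemma src_tgt_b_structure [simp]:
  "src b_ev = \<langle>X\<rangle> \<odot> \<langle>Xd\<rangle>" "tgt b_ev = BUnit" "src b_coev = BUnit" "tgt b_coev = \<langle>Xd\<rangle> \<odot> \<langle>X\<rangle>"
  "src (b_mult A) = \<langle>carrier A\<rangle> \<odot> \<langle>carrier A\<rangle>" "tgt (b_mult A) = \<langle>carrier A\<rangle>"
  "src (b_one A) = BUnit" "tgt (b_one A) = \<langle>carrier A\<rangle>"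
  "src (b_comult A) = \<langle>carrier A\<rangle>" "tgt (b_comult A) = \<langle>carrier A\<rangle> \<odot> \<langle>carrier A\<rangle>"
  "src (b_counit A) = \<langle>carrier A\<rangle>" "tgt (b_counit A) = BUnit"
  by (simp_all add: b_defs)

lemma hopf_K: "hopf_algebra C K" and duality: "duality C X Xd ev coev"
  using dual_hopf by (simp_all add: dual_hopf_algebra_def Let_def)

lemma carriers_Obj [simp]: "X \<in> Obj C" "Xd \<in> Obj C"
  using duality by (simp_all add: duality_def)

lemma barrow_b_structure [simp]: "barrow b_ev" "barrow b_coev"
  "barrow (b_mult H)" "barrow (b_one H)" "barrow (b_comult H)" "barrow (b_counit H)"
  "barrow (b_mult K)" "barrow (b_one K)" "barrow (b_comult K)" "barrow (b_counit K)"
  using hopf hopf_K duality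
  by (simp_all add: barrow_def b_defs hopf_algebra_def duality_def Let_def)

lemma zigzag:
  assumes [simp]: "N \<in> Obj C"
  shows "Hat b_ev (X \<boxtimes> N) \<star> (X \<rhd> Hat b_coev N) = tid (X \<boxtimes> N)"
    and "(Xd \<rhd> Hat b_ev N) \<star> Hat b_coev (Xd \<boxtimes> N) = tid (Xd \<boxtimes> N)"
proof -
  let ?x = "\<langle>X\<rangle>" and ?y = "\<langle>Xd\<rangle>"
  have "blunit ?x \<star> (b_ev \<uplus> bid ?x) \<star> binv (bassoc ?x ?y ?x) \<star> (bid ?x \<uplus> b_coev) \<star> binv (brunit ?x)
      = bid ?x"
    and "brunit ?y \<star> (bid ?y \<uplus> b_ev) \<star> bassoc ?y ?x ?y \<star> (b_coev \<uplus> bid ?y) \<star> binv (blunit ?y)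
      = bid ?y"
    using duality by (simp_all add: duality_def bdefs b_defs)
  from this [THEN arg_cong, of "\<lambda>h. Hat h N"]
  show "Hat b_ev (X \<boxtimes> N) \<star> (X \<rhd> Hat b_coev N) = tid (X \<boxtimes> N)"
    and "(Xd \<rhd> Hat b_ev N) \<star> Hat b_coev (Xd \<boxtimes> N) = tid (Xd \<boxtimes> N)"
    by (simp_all add: Hat_simps)
qed

text \<open>These are the dualization equations with associators erased; the nested pairing becomes
  two evaluations in succession, the inner pair first.\<close>

lemma dual_ev:
  assumes [simp]: "N \<in> Obj C"
  shows "Hat b_ev N \<star> (X \<rhd> Hat (b_mult K) N)
      = Hat b_ev N \<star> (X \<rhd> Hat b_ev (Xd \<boxtimes> N)) \<star> Hat (b_comult H) (Xd \<boxtimes> Xd \<boxtimes> N)"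
    and "Hat b_ev N \<star> (X \<rhd> Hat (b_one K) N) = Hat (b_counit H) N"
    and "Hat (b_counit K) N = Hat b_ev N \<star> Hat (b_one H) (Xd \<boxtimes> N)"
proof -
  let ?x = "\<langle>X\<rangle>" and ?y = "\<langle>Xd\<rangle>"
  have "b_ev \<star> (bid ?x \<uplus> b_mult K)
      = (b_ev \<star> (bid ?x \<uplus> (blunit ?y \<star> (b_ev \<uplus> bid ?y) \<star> binv (bassoc ?x ?y ?y)))
          \<star> bassoc ?x ?x (?y \<odot> ?y)) \<star> (b_comult H \<uplus> bid (?y \<odot> ?y))"
    and "b_ev \<star> (bid ?x \<uplus> b_one K) = b_counit H \<star> brunit ?x"
    and "b_counit K \<star> blunit ?y = b_ev \<star> (b_one H \<uplus> bid ?y)"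
    using dual_hopf
    by (simp_all add: dual_hopf_algebra_def nested_pairing_def Let_def bdefs b_defs)
  from this [THEN arg_cong, of "\<lambda>h. Hat h N"]
  show "Hat b_ev N \<star> (X \<rhd> Hat (b_mult K) N)
      = Hat b_ev N \<star> (X \<rhd> Hat b_ev (Xd \<boxtimes> N)) \<star> Hat (b_comult H) (Xd \<boxtimes> Xd \<boxtimes> N)"
    and "Hat b_ev N \<star> (X \<rhd> Hat (b_one K) N) = Hat (b_counit H) N"
    and "Hat (b_counit K) N = Hat b_ev N \<star> Hat (b_one H) (Xd \<boxtimes> N)"
    by (simp_all add: Hat_simps)
qed

lemma Hat_mult_one:
  assumes A: "A = H \<or> A = K" and [simp]: "N \<in> Obj C"
  shows "Hat (b_mult A) N \<star> Hat (b_one A) (carrier A \<boxtimes> N) = tid (carrier A \<boxtimes> N)"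
    and "Hat (b_mult A) N \<star> (carrier A \<rhd> Hat (b_one A) N) = tid (carrier A \<boxtimes> N)"
proof -
  let ?x = "\<langle>carrier A\<rangle>"
  have [simp]: "carrier A \<in> Obj C" "barrow (b_mult A)" "barrow (b_one A)" using A by auto
  have "b_mult A \<star> (b_one A \<uplus> bid ?x) = blunit ?x" "b_mult A \<star> (bid ?x \<uplus> b_one A) = brunit ?x"
    using hopf hopf_K A by (auto simp: hopf_algebra_def Let_def bdefs b_defs)
  from this [THEN arg_cong, of "\<lambda>h. Hat h N"]
  show "Hat (b_mult A) N \<star> Hat (b_one A) (carrier A \<boxtimes> N) = tid (carrier A \<boxtimes> N)"
    and "Hat (b_mult A) N \<star> (carrier A \<rhd> Hat (b_one A) N) = tid (carrier A \<boxtimes> N)"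
    by (simp_all add: Hat_simps)
qed

lemma Hat_counit_comult:
  assumes [simp]: "N \<in> Obj C"
  shows "(Xd \<rhd> Hat (b_counit K) N) \<star> Hat (b_comult K) N = tid (Xd \<boxtimes> N)"
proof -
  let ?x = "\<langle>Xd\<rangle>"
  have "brunit ?x \<star> (bid ?x \<uplus> b_counit K) \<star> b_comult K = bid ?x"
    using hopf_K by (simp add: hopf_algebra_def Let_def bdefs b_defs)
  from arg_cong [OF this, of "\<lambda>h. Hat h N"] show ?thesis by (simp add: Hat_simps)
qed

section \<open>Coactions, \<open>Omega\<close> and tensor products as bracketed arrows\<close>

text \<open>\<open>f\<close> stands for the action of \<open>X\<^sup>*\<close> on \<open>tgt f\<close>.\<close>

definition "b_coact f = brd (tgt f) \<langle>X\<rangle> \<star> (f \<uplus> bid \<langle>X\<rangle>) \<star> (binv (brd \<langle>Xd\<rangle> (tgt f)) \<uplus> bid \<langle>X\<rangle>)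
  \<star> binv (bassoc (tgt f) \<langle>Xd\<rangle> \<langle>X\<rangle>) \<star> (bid (tgt f) \<uplus> b_coev) \<star> binv (brunit (tgt f))"

lemma src_tgt_b_coact [simp]: "src (b_coact f) = tgt f" "tgt (b_coact f) = \<langle>X\<rangle> \<odot> tgt f"
  by (simp_all add: b_coact_def)

lemma barrow_b_coact [simp]:
  "\<lbrakk>barrow f; src f = \<langle>Xd\<rangle> \<odot> tgt f\<rbrakk> \<Longrightarrow> barrow (b_coact f)"
  by (simp add: b_coact_def)

lemma Hat_b_coact:
  assumes "barrow f" "src f = \<langle>Xd\<rangle> \<odot> tgt f" "N \<in> Obj C"
  shows "Hat (b_coact f) N = Hat (brd (tgt f) \<langle>X\<rangle>) N \<star> Hat f (X \<boxtimes> N)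
    \<star> tinv (Hat (brd \<langle>Xd\<rangle> (tgt f)) (X \<boxtimes> N)) \<star> whisks (tgt f) (Hat b_coev N)"
  using assms unfolding b_coact_def by (simp add: Hat_tcomp Hat_btensor Hat_binv)

lemma arr_b_coact:
  assumes "ob W = val (tgt f)" "act W = arr f"
  shows "arr (b_coact f) = dual_coact C H K coev W"
  using assms by (simp add: b_coact_def dual_coact_def Let_def brd_def bdefs b_defs braid_inv_def)

text \<open>\<open>d\<close> stands for the coaction of \<open>X\<close> on \<open>src d\<close>.\<close>

definition "b_Omega d = brunit (src d) \<star> (bid (src d) \<uplus> b_ev) \<star> bassoc (src d) \<langle>X\<rangle> \<langle>Xd\<rangle>
  \<star> (binv (brd (src d) \<langle>X\<rangle>) \<uplus> bid \<langle>Xd\<rangle>) \<star> (d \<uplus> bid \<langle>Xd\<rangle>) \<star> brd \<langle>Xd\<rangle> (src d)"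

lemma src_tgt_b_Omega [simp]: "src (b_Omega d) = \<langle>Xd\<rangle> \<odot> src d" "tgt (b_Omega d) = src d"
  by (simp_all add: b_Omega_def)

lemma barrow_b_Omega [simp]: "\<lbrakk>barrow d; tgt d = \<langle>X\<rangle> \<odot> src d\<rbrakk> \<Longrightarrow> barrow (b_Omega d)"
  by (simp add: b_Omega_def)

lemma Hat_b_Omega:
  assumes "barrow d" "tgt d = \<langle>X\<rangle> \<odot> src d" "N \<in> Obj C"
  shows "Hat (b_Omega d) N = whisks (src d) (Hat b_ev N) \<star> tinv (Hat (brd (src d) \<langle>X\<rangle>) (Xd \<boxtimes> N))
    \<star> Hat d (Xd \<boxtimes> N) \<star> Hat (brd \<langle>Xd\<rangle> (src d)) N"
  using assms unfolding b_Omega_def by (simp add: Hat_tcomp Hat_btensor Hat_binv)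

lemma arr_b_Omega:
  "\<lbrakk>val (src d) = ob Z; arr d = coact Z\<rbrakk> \<Longrightarrow> arr (b_Omega d) = act (Omega C H K ev coev Z)"
  by (simp add: b_Omega_def Omega_def Let_def brd_def bdefs b_defs braid_inv_def)

text \<open>The braidings of \<open>Xd\<close> with \<open>Z\<close> cancel; \<open>coev\<close>
  then slides past \<open>d\<close> and the inverse braiding until it meets \<open>ev\<close>, where
  the zigzag identity removes both; the braidings of \<open>Z\<close> with \<open>X\<close> cancel
  last.\<close>

lemma b_coact_b_Omega:
  assumes [simp]: "barrow d" "src d = \<langle>Z\<rangle>" "tgt d = \<langle>X\<rangle> \<odot> \<langle>Z\<rangle>"
  shows "b_coact (b_Omega d) = d"
proof (rule Hat_faithful)
  have Z [simp]: "Z \<in> Obj C" using barrow_wf(1) [of d] by simp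
  have d: "Hat d M \<star> (Z \<rhd> h) = (X \<rhd> Z \<rhd> h) \<star> Hat d (src h)" if "arrow h" "tgt h = M" for h M
    using Hat_natural [of d h] that by simp
  note rules = d tinv_br_slide [THEN tcomp_left_cong] zigzag(1) [THEN whisk_cong, THEN tcomp_left_cong]
  show "Hat (b_coact (b_Omega d)) \<one> = Hat d \<one>"
    by (simp add: Hat_b_coact Hat_b_Omega Hat_simps rules)
qed simp_all

lemma arr_bracketed:
  "arr (f \<uplus> g) = arr f \<otimes> arr g" "arr (bid a) = \<ii> (val a)"
  "arr (bassoc a b d) = \<alpha> (val a) (val b) (val d)"
  "arr (binv (bassoc a b d)) = \<alpha>' (val a) (val b) (val d)"
  by (simp_all add: bdefs)

definition "b_tensor_act f g = (f \<uplus> g) \<star> (binv (bassoc \<langle>Xd\<rangle> (tgt f) (\<langle>Xd\<rangle> \<odot> tgt g))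
  \<star> (bid \<langle>Xd\<rangle> \<uplus> (bassoc (tgt f) \<langle>Xd\<rangle> (tgt g) \<star> (brd \<langle>Xd\<rangle> (tgt f) \<uplus> bid (tgt g))
    \<star> binv (bassoc \<langle>Xd\<rangle> (tgt f) (tgt g))))
  \<star> bassoc \<langle>Xd\<rangle> \<langle>Xd\<rangle> (tgt f \<odot> tgt g)) \<star> (b_comult K \<uplus> bid (tgt f \<odot> tgt g))"

lemma src_tgt_b_tensor_act [simp]:
  "src (b_tensor_act f g) = \<langle>Xd\<rangle> \<odot> tgt f \<odot> tgt g" "tgt (b_tensor_act f g) = tgt f \<odot> tgt g"
  by (simp_all add: b_tensor_act_def)

lemma barrow_b_tensor_act [simp]:
  "\<lbrakk>barrow f; barrow g; src f = \<langle>Xd\<rangle> \<odot> tgt f; src g = \<langle>Xd\<rangle> \<odot> tgt g\<rbrakk> \<Longrightarrow> barrow (b_tensor_act f g)"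
  by (simp add: b_tensor_act_def)

lemma Hat_b_tensor_act:
  assumes "barrow f" "barrow g" "src f = \<langle>Xd\<rangle> \<odot> tgt f" "src g = \<langle>Xd\<rangle> \<odot> tgt g" "N \<in> Obj C"
  shows "Hat (b_tensor_act f g) N = Hat f (app (tgt g) N) \<star> (Xd \<rhd> whisks (tgt f) (Hat g N))
    \<star> (Xd \<rhd> Hat (brd \<langle>Xd\<rangle> (tgt f)) (app (tgt g) N)) \<star> Hat (b_comult K) (app (tgt f) (app (tgt g) N))"
  using assms unfolding b_tensor_act_def by (simp add: Hat_tcomp Hat_btensor Hat_binv)

lemma arr_b_tensor_act:
  assumes "val (tgt f) = ob V" "arr f = act V" "val (tgt g) = ob W" "arr g = act W"
  shows "arr (b_tensor_act f g) = tensor_act C K V W"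
  using assms by (simp add: b_tensor_act_def tensor_act_def interchange_def brd_def bdefs b_defs)

definition "b_trivial_act A = blunit \<langle>A\<rangle> \<star> (b_counit K \<uplus> bid \<langle>A\<rangle>)"

lemma src_tgt_b_trivial_act [simp]: "src (b_trivial_act A) = \<langle>Xd\<rangle> \<odot> \<langle>A\<rangle>" "tgt (b_trivial_act A) = \<langle>A\<rangle>"
  by (simp_all add: b_trivial_act_def)

lemma barrow_b_trivial_act [simp]: "A \<in> Obj C \<Longrightarrow> barrow (b_trivial_act A)"
  by (simp add: b_trivial_act_def)

lemma Hat_b_trivial_act: "\<lbrakk>A \<in> Obj C; N \<in> Obj C\<rbrakk> \<Longrightarrow> Hat (b_trivial_act A) N = Hat (b_counit K) (A \<boxtimes> N)"
  by (simp add: b_trivial_act_def Hat_simps)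

text \<open>The counit acting on \<open>A\<close> slides back through the braiding to the
  comultiplication, where the counit law removes both.\<close>

lemma b_tensor_act_b_trivial_act:
  assumes "barrow f" "src f = \<langle>Xd\<rangle> \<odot> tgt f" "tgt f = \<langle>V\<rangle>" "A \<in> Obj C" "N \<in> Obj C"
  shows "Hat (b_tensor_act f (b_trivial_act A)) N = Hat f (A \<boxtimes> N)"
proof -
  have [simp]: "V \<in> Obj C" using barrow_wf(2) [OF assms(1)] assms(3) by simp
  have "(V \<rhd> Hat (b_counit K) M) \<star> br Xd V M = Hat (b_counit K) (V \<boxtimes> M)" if "M \<in> Obj C" for M
    using Hat_brd_left [of "b_counit K" "\<langle>V\<rangle>" M] that by (simp add: br_def)
  note rules = this [THEN whisk_cong, THEN tcomp_left_cong]
  show ?thesis using assms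
    by (simp add: Hat_b_tensor_act Hat_b_trivial_act Hat_simps rules Hat_counit_comult)
qed

section \<open>The constraint \<open>a\<close> in strict form, and transparency of
  \<open>X\<close>\<close>

definition "b_mid f m g = bassoc (tgt f) m (tgt g) \<star> ((f \<uplus> bid m) \<uplus> bid (tgt g))
  \<star> (binv (bassoc \<langle>X\<rangle> (tgt f) m) \<uplus> bid (tgt g)) \<star> (binv (brd \<langle>X\<rangle> (tgt f \<odot> m)) \<uplus> bid (tgt g))
  \<star> binv (bassoc (tgt f \<odot> m) \<langle>X\<rangle> (tgt g)) \<star> (bid (tgt f \<odot> m) \<uplus> b_coact g)"

lemma src_tgt_b_mid [simp]:
  "src (b_mid f m g) = (tgt f \<odot> m) \<odot> tgt g" "tgt (b_mid f m g) = tgt f \<odot> m \<odot> tgt g"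
  by (simp_all add: b_mid_def)

lemma barrow_b_mid [simp]:
  "\<lbrakk>barrow f; barrow g; src f = \<langle>X\<rangle> \<odot> tgt f; src g = \<langle>Xd\<rangle> \<odot> tgt g; wf m\<rbrakk> \<Longrightarrow> barrow (b_mid f m g)"
  by (simp add: b_mid_def)

lemma Hat_b_mid:
  assumes "barrow f" "barrow g" "src f = \<langle>X\<rangle> \<odot> tgt f" "src g = \<langle>Xd\<rangle> \<odot> tgt g" "wf m" "N \<in> Obj C"
  shows "Hat (b_mid f m g) N = Hat f (app m (app (tgt g) N))
    \<star> tinv (Hat (brd \<langle>X\<rangle> (tgt f \<odot> m)) (app (tgt g) N)) \<star> whisks (tgt f) (whisks m (Hat (b_coact g) N))"
  using assms unfolding b_mid_def
  by (simp add: Hat_tcomp Hat_btensor Hat_binv)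

lemma arr_b_mid:
  assumes "val (tgt f) = ob V" "arr f = act V" "val m = M" "val (tgt g) = ob W" "arr g = act W"
  shows "arr (b_mid f m g) = mid_constraint C H K coev V M W"
  using assms arr_b_coact [of W g]
  by (simp add: b_mid_def mid_constraint_def Let_def brd_def bdefs b_defs braid_inv_def)

text \<open>Naturality of the braiding for \<open>coev\<close>, whose source is the unit and hence
  braids trivially; one of the two crossings is moved to the other side.\<close>

lemma coev_slide:
  assumes "A \<in> Obj C" "N \<in> Obj C"
  shows "tinv (br Xd A (X \<boxtimes> N)) \<star> (A \<rhd> Hat b_coev N) = (Xd \<rhd> br X A N) \<star> Hat b_coev (A \<boxtimes> N)"
proof (rule iso_cancel_left [of "br Xd A (X \<boxtimes> N)"])
  show "br Xd A (X \<boxtimes> N) \<star> tinv (br Xd A (X \<boxtimes> N)) \<star> (A \<rhd> Hat b_coev N)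
      = br Xd A (X \<boxtimes> N) \<star> (Xd \<rhd> br X A N) \<star> Hat b_coev (A \<boxtimes> N)"
    using assms Hat_brd_left [of b_coev "\<langle>A\<rangle>" N]
    by (simp add: Hat_simps)
qed (use assms in auto)

lemma one_slide:
  "\<lbrakk>A = H \<or> A = K; arrow h; tgt h = M\<rbrakk>
   \<Longrightarrow> Hat (b_one A) M \<star> h = (carrier A \<rhd> h) \<star> Hat (b_one A) (src h)"
  using Hat_natural [of "b_one A" h] by auto

text \<open>The counit of \<open>K\<close> is evaluation at the unit of \<open>X\<close>, so this is
  the zigzag identity applied to that unit.\<close>

lemma counit_coev:
  "N \<in> Obj C \<Longrightarrow> Hat (b_counit K) (X \<boxtimes> N) \<star> Hat b_coev N = Hat (b_one H) N"
  using one_slide [of H "Hat b_coev N"]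
  by (simp add: dual_ev(3) zigzag(1) [THEN tcomp_left_cong])

text \<open>The counit passes the inverse braiding and turns \<open>coev\<close> into the unit of
  \<open>X\<close>: a trivial action corresponds to a trivial coaction.\<close>

lemma b_coact_b_trivial_act:
  assumes [simp]: "A \<in> Obj C" "N \<in> Obj C"
  shows "Hat (b_coact (b_trivial_act A)) N = Hat (b_one H) (A \<boxtimes> N)"
proof -
  have "Hat (b_counit K) (A \<boxtimes> M) \<star> tinv (br Xd A M) = A \<rhd> Hat (b_counit K) M" if "M \<in> Obj C" for M
  proof (rule iso_cancel_right [of _ "br Xd A M"])
    show "(Hat (b_counit K) (A \<boxtimes> M) \<star> tinv (br Xd A M)) \<star> br Xd A M
        = (A \<rhd> Hat (b_counit K) M) \<star> br Xd A M"
      using that Hat_brd_left [of "b_counit K" "\<langle>A\<rangle>" M] by (simp add: br_def)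
  qed (use that in auto)
  note rules = this [THEN tcomp_left_cong]
  have "br A X N \<star> (A \<rhd> Hat (b_one H) N) = Hat (b_one H) (A \<boxtimes> N)"
    using Hat_brd_right [of "b_one H" "\<langle>A\<rangle>" N] by (simp add: br_def)
  then show ?thesis
    by (simp add: Hat_b_coact Hat_b_trivial_act Hat_simps rules counit_coev [THEN whisk_cong])
qed

lemma module_regular:
  assumes "A = H \<or> A = K" shows "is_module C A (carrier A) (mult A)"
  using assms hopf hopf_K by (auto simp: is_module_def hopf_algebra_def Let_def)

text \<open>The counit is multiplicative and unital. Since any object carries this action,
  \<open>U\<close> can be arbitrary in \<open>transparent\<close>.\<close>

lemma module_trivial:
  assumes [simp]: "A \<in> Obj C" shows "is_module C K A (\<ll> A \<cdot> (counit K \<otimes> \<ii> A))"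
proof -
  let ?y = "\<langle>Xd\<rangle>" and ?a = "\<langle>A\<rangle>" and ?r = "b_trivial_act A"
  have "b_counit K \<star> b_mult K = blunit BUnit \<star> (b_counit K \<uplus> b_counit K)"
    and "b_counit K \<star> b_one K = bid BUnit"
    using hopf_K by (simp_all add: hopf_algebra_def Let_def bdefs b_defs)
  from this [THEN arg_cong, of "\<lambda>h. Hat h (A \<boxtimes> \<one>)"]
  have hats: "Hat (b_counit K) (A \<boxtimes> \<one>) \<star> Hat (b_mult K) (A \<boxtimes> \<one>)
      = Hat (b_counit K) (A \<boxtimes> \<one>) \<star> (Xd \<rhd> Hat (b_counit K) (A \<boxtimes> \<one>))"
    "Hat (b_counit K) (A \<boxtimes> \<one>) \<star> Hat (b_one K) (A \<boxtimes> \<one>) = tid (A \<boxtimes> \<one>)"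
    by (simp_all add: Hat_simps)
  have "?r \<star> (b_mult K \<uplus> bid ?a) = ?r \<star> (bid ?y \<uplus> ?r) \<star> bassoc ?y ?y ?a"
    by (rule Hat_faithful) (simp_all add: Hat_simps Hat_b_trivial_act hats)
  moreover have "?r \<star> (b_one K \<uplus> bid ?a) = blunit ?a"
    by (rule Hat_faithful) (simp_all add: Hat_simps Hat_b_trivial_act hats)
  ultimately show ?thesis
    using barrow_b_trivial_act [OF assms]
    by (simp add: is_module_def Let_def barrow_def b_trivial_act_def bdefs b_defs del: barrow_b_trivial_act)
qed

lemma tinv_br_one:
  assumes "A = H \<or> A = K" and [simp]: "B \<in> Obj C" "N \<in> Obj C"
  shows "tinv (br (carrier A) B N) \<star> (B \<rhd> Hat (b_one A) N) = Hat (b_one A) (B \<boxtimes> N)"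
    and "tinv (br B (carrier A) N) \<star> Hat (b_one A) (B \<boxtimes> N) = B \<rhd> Hat (b_one A) N"
proof -
  have [simp]: "carrier A \<in> Obj C" "barrow (b_one A)" using assms(1) by auto
  have "br (carrier A) B N \<star> Hat (b_one A) (B \<boxtimes> N) = B \<rhd> Hat (b_one A) N"
    and "br B (carrier A) N \<star> (B \<rhd> Hat (b_one A) N) = Hat (b_one A) (B \<boxtimes> N)"
    using Hat_brd_left [of "b_one A" "\<langle>B\<rangle>" N] Hat_brd_right [of "b_one A" "\<langle>B\<rangle>" N]
    by (simp_all add: br_def)
  from this [THEN tinv_tcomp_eq]
  show "tinv (br (carrier A) B N) \<star> (B \<rhd> Hat (b_one A) N) = Hat (b_one A) (B \<boxtimes> N)"
    and "tinv (br B (carrier A) N) \<star> Hat (b_one A) (B \<boxtimes> N) = B \<rhd> Hat (b_one A) N"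
    by simp_all
qed

text \<open>Inserting the unit recovers \<open>h\<close> from its composite with the inverse
  braiding and the multiplication. This strips the regular actions from the pentagon.\<close>

lemma mult_tinv_br_one:
  assumes A: "A = H \<or> A = K" and h: "arrow h" "tgt h = carrier A \<boxtimes> M" and M: "M \<in> Obj C"
  shows "Hat (b_mult A) M \<star> tinv (br (carrier A) (carrier A) M) \<star> (carrier A \<rhd> h)
    \<star> Hat (b_one A) (src h) = h"
proof -
  have [simp]: "carrier A \<in> Obj C" "barrow (b_one A)" "barrow (b_mult A)" using A by auto
  show ?thesis using h M one_slide [OF A h(1), symmetric]
    by (simp add: tinv_br_one [OF A, THEN tcomp_left_cong] Hat_mult_one [OF A, THEN tcomp_left_cong])
qed

text \<open>The right pentagon at \<open>V = X\<close>, \<open>M = \<one>\<close>, \<open>W = X\<^sup>*\<close> and \<open>W' = U\<close> with the trivial action,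
  evaluated at the units of \<open>X\<close> and \<open>X\<^sup>*\<close>, says that the double braiding of \<open>X\<close> and \<open>U\<close> fixes
  \<open>coev \<otimes> U\<close>; the zigzag identity then removes \<open>coev\<close>.\<close>

lemma transparent:
  assumes bim: "bimodule_category (Mod C H) (Mod C K) (bimod_M C H K coev)"
    and U [simp]: "U \<in> Obj C" and N [simp]: "N \<in> Obj C"
  shows "br U X N \<star> br X U N = tid (X \<boxtimes> U \<boxtimes> N)"
proof -
  let ?x = "\<langle>X\<rangle>" and ?y = "\<langle>Xd\<rangle>" and ?u = "\<langle>U\<rangle>"
    and ?t = "b_trivial_act U" and ?m = "b_mult H" and ?k = "b_mult K"
  let ?V = "\<lparr>ob = X, act = mult H\<rparr>" and ?W = "\<lparr>ob = Xd, act = mult K\<rparr>"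
  let ?U = "\<lparr>ob = U, act = \<ll> U \<cdot> (counit K \<otimes> \<ii> U)\<rparr>"
  let ?WU = "\<lparr>ob = Xd \<boxtimes> U, act = tensor_act C K ?W ?U\<rparr>"
  have arr: "arr ?m = mult H" "arr ?k = mult K" "arr ?t = \<ll> U \<cdot> (counit K \<otimes> \<ii> U)"
    by (simp_all add: b_defs b_trivial_act_def bdefs)
  \<comment> \<open>The pentagon of the hypothesis, rewritten between bracketed words with
    \<open>BUnit\<close> in the middle slot so that \<open>Hat\<close> applies.\<close>
  have "(bid ?x \<uplus> binv (bassoc BUnit ?y ?u)) \<star> b_mid ?m BUnit (b_tensor_act ?k ?t)
      = b_mid ?m (BUnit \<odot> ?y) ?t \<star> (b_mid ?m BUnit ?k \<uplus> bid ?u) \<star> binv (bassoc (?x \<odot> BUnit) ?y ?u)"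
    (is "?l = ?r")
  proof (rule tarr_eqI)
    have mods: "?V \<in> Obj (Mod C H)" "?W \<in> Obj (Mod C K)" "?U \<in> Obj (Mod C K)"
      using module_regular module_trivial by (simp_all add: Mod_def)
    show "arr ?l = arr ?r"
      using bimodule_category.mid_right_pentagon [OF bim mods(1) _ mods(2,3), of "\<one>"]
        arr_b_tensor_act [of ?k ?W ?t ?U] arr_b_mid [of ?m ?V BUnit "\<one>" "b_tensor_act ?k ?t" ?WU]
        arr_b_mid [of ?m ?V "BUnit \<odot> ?y" "\<one> \<boxtimes> Xd" ?t ?U] arr_b_mid [of ?m ?V BUnit "\<one>" ?k ?W]
      by (simp add: Mod_def bimod_M_def arr_bracketed arr)
  qed simp_all
  from arg_cong [OF this, of "\<lambda>h. Hat h N"]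
  \<comment> \<open>On the right the constraint involving \<open>?U\<close> has become an identity:
    the trivial coaction inserts the unit of \<open>X\<close>, which passes the strands and is
    absorbed by the multiplication.\<close>
  have "Hat ?m (Xd \<boxtimes> U \<boxtimes> N) \<star> tinv (br X X (Xd \<boxtimes> U \<boxtimes> N)) \<star> (X \<rhd> Hat (b_coact (b_tensor_act ?k ?t)) N)
      = Hat ?m (Xd \<boxtimes> U \<boxtimes> N) \<star> tinv (br X X (Xd \<boxtimes> U \<boxtimes> N)) \<star> (X \<rhd> Hat (b_coact ?k) (U \<boxtimes> N))"
    by (simp add: Hat_tcomp Hat_btensor Hat_binv Hat_b_mid b_coact_b_trivial_act Hat_brd_tensor_right
        br_def [symmetric] tinv_tcomp_distrib tinv_whisk tinv_br_one [THEN whisk_cong, THEN tcomp_left_cong]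
        tinv_br_one [THEN tcomp_left_cong] Hat_mult_one [THEN tcomp_left_cong])
  \<comment> \<open>Inserting the unit of \<open>X\<close> in the slot of \<open>V\<close> strips
    the regular action of \<open>X\<close> on both sides.\<close>
  from arg_cong [OF this, of "\<lambda>h. h \<star> Hat (b_one H) (Xd \<boxtimes> U \<boxtimes> N)"]
  have "Hat (b_coact (b_tensor_act ?k ?t)) N = Hat (b_coact ?k) (U \<boxtimes> N)"
    using mult_tinv_br_one [of H "Hat (b_coact ?k) (U \<boxtimes> N)" "Xd \<boxtimes> U \<boxtimes> N"]
      mult_tinv_br_one [of H "Hat (b_coact (b_tensor_act ?k ?t)) N" "Xd \<boxtimes> U \<boxtimes> N"]
    by simp
  \<comment> \<open>Both coactions unfolded. A crossing of \<open>X\<close> and \<open>U\<close>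
    arises twice: from braiding \<open>Xd \<boxtimes> U\<close> with \<open>X\<close>, and from
    sliding \<open>coev\<close> over \<open>U\<close>.\<close>
  then have "br Xd X (U \<boxtimes> N) \<star> (Xd \<rhd> br U X N) \<star> Hat ?k (U \<boxtimes> X \<boxtimes> N) \<star> tinv (br Xd Xd (U \<boxtimes> X \<boxtimes> N))
        \<star> (Xd \<rhd> Xd \<rhd> br X U N) \<star> (Xd \<rhd> Hat b_coev (U \<boxtimes> N))
      = br Xd X (U \<boxtimes> N) \<star> Hat ?k (X \<boxtimes> U \<boxtimes> N) \<star> tinv (br Xd Xd (X \<boxtimes> U \<boxtimes> N))
        \<star> (Xd \<rhd> Hat b_coev (U \<boxtimes> N))"
    by (simp add: Hat_b_coact Hat_simps b_tensor_act_b_trivial_act coev_slide [THEN whisk_cong])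
  then have "(Xd \<rhd> br U X N) \<star> Hat ?k (U \<boxtimes> X \<boxtimes> N) \<star> tinv (br Xd Xd (U \<boxtimes> X \<boxtimes> N))
        \<star> (Xd \<rhd> ((Xd \<rhd> br X U N) \<star> Hat b_coev (U \<boxtimes> N)))
      = Hat ?k (X \<boxtimes> U \<boxtimes> N) \<star> tinv (br Xd Xd (X \<boxtimes> U \<boxtimes> N)) \<star> (Xd \<rhd> Hat b_coev (U \<boxtimes> N))"
    by - (rule iso_cancel_left [of "br Xd X (U \<boxtimes> N)"], auto)
  \<comment> \<open>The same device with the unit of \<open>Xd\<close> strips the multiplication of
    \<open>K\<close> and brings the two crossings together.\<close>
  from arg_cong [OF this, of "\<lambda>h. h \<star> Hat (b_one K) (U \<boxtimes> N)"]
  have coev: "(Xd \<rhd> (br U X N \<star> br X U N)) \<star> Hat b_coev (U \<boxtimes> N) = Hat b_coev (U \<boxtimes> N)"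
    using mult_tinv_br_one [of K "Hat b_coev (U \<boxtimes> N)" "X \<boxtimes> U \<boxtimes> N"]
      mult_tinv_br_one [of K "(Xd \<rhd> br X U N) \<star> Hat b_coev (U \<boxtimes> N)" "U \<boxtimes> X \<boxtimes> N"]
    by simp
  let ?D = "br U X N \<star> br X U N"
  have "?D = ?D \<star> Hat b_ev (X \<boxtimes> U \<boxtimes> N) \<star> (X \<rhd> Hat b_coev (U \<boxtimes> N))"
    by (simp add: zigzag)
  also have "\<dots> = (?D \<star> Hat b_ev (X \<boxtimes> U \<boxtimes> N)) \<star> (X \<rhd> Hat b_coev (U \<boxtimes> N))"
    by simp
  also have "?D \<star> Hat b_ev (X \<boxtimes> U \<boxtimes> N) = Hat b_ev (X \<boxtimes> U \<boxtimes> N) \<star> (X \<rhd> Xd \<rhd> ?D)"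
    using Hat_natural [of b_ev ?D] by simp
  also have "(\<dots>) \<star> (X \<rhd> Hat b_coev (U \<boxtimes> N))
      = Hat b_ev (X \<boxtimes> U \<boxtimes> N) \<star> (X \<rhd> ((Xd \<rhd> ?D) \<star> Hat b_coev (U \<boxtimes> N)))"
    by simp
  also have "\<dots> = tid (X \<boxtimes> U \<boxtimes> N)"
    unfolding coev by (simp add: zigzag)
  finally show ?thesis .
qed

section \<open>\<open>\<Omega> Z\<close> is a module\<close>

text \<open>The action pairs \<open>Xd\<close> with the right coaction \<open>p\<close> below.
  Coassociativity of \<open>p\<close> carries an inverse braiding, and exactly this converts the
  side by side pairing of two successive actions into the nested pairing that defines the
  multiplication of \<open>K\<close>.\<close>

lemma module_Omega:
  assumes "is_comodule C H (ob Z) (coact Z)"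
  shows "is_module C K (ob Z) (act (Omega C H K ev coev Z))"
proof -
  let ?Z = "ob Z"
  define z x y d where "z = \<langle>?Z\<rangle>" and "x = \<langle>X\<rangle>" and "y = \<langle>Xd\<rangle>" and "d = TArr z (coact Z) (x \<odot> z)"
  have Z [simp]: "?Z \<in> Obj C" using assms by (simp add: is_comodule_def Let_def)
  have [simp]: "src d = \<langle>?Z\<rangle>" "tgt d = \<langle>X\<rangle> \<odot> \<langle>?Z\<rangle>" by (simp_all add: d_def z_def x_def)
  have d [simp]: "barrow d"
    using assms by (simp add: barrow_def d_def x_def z_def is_comodule_def Let_def)
  have comod: "bassoc x x z \<star> (b_comult H \<uplus> bid z) \<star> d = (bid x \<uplus> d) \<star> d"
    "blunit z \<star> (b_counit H \<uplus> bid z) \<star> d = bid z"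
    using assms by (simp_all add: is_comodule_def Let_def bdefs b_defs d_def z_def x_def)
  have coassoc: "Hat (b_comult H) (?Z \<boxtimes> M) \<star> Hat d M = (X \<rhd> Hat d M) \<star> Hat d M"
    and counit: "Hat (b_counit H) (?Z \<boxtimes> M) \<star> Hat d M = tid (?Z \<boxtimes> M)" if "M \<in> Obj C" for M
    using that comod [THEN arg_cong, of "\<lambda>h. Hat h M"] by (simp_all add: Hat_simps x_def z_def)

  \<comment> \<open>\<open>p\<close> is \<open>d\<close> as a right coaction, for the opposite comultiplication.\<close>
  define p where "p = binv (brd z x) \<star> d"
  have p [simp]: "barrow p" "src p = \<langle>?Z\<rangle>" "tgt p = \<langle>?Z\<rangle> \<odot> \<langle>X\<rangle>"
    by (simp_all add: p_def z_def x_def)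
  have Hat_p: "Hat p M = tinv (br ?Z X M) \<star> Hat d M" if "M \<in> Obj C" for M
    using that by (simp add: p_def z_def x_def Hat_simps)
  have p_slide: "Hat p M \<star> (?Z \<rhd> h) = (?Z \<rhd> X \<rhd> h) \<star> Hat p (src h)" if "arrow h" "tgt h = M" for h M
    using Hat_natural [of p h] that by simp

  have p_counit: "(?Z \<rhd> Hat (b_counit H) M) \<star> Hat p M = tid (?Z \<boxtimes> M)" if "M \<in> Obj C" for M
  proof -
    have "(?Z \<rhd> Hat (b_counit H) M) \<star> tinv (br ?Z X M) = Hat (b_counit H) (?Z \<boxtimes> M)"
      using that tinv_square [of "tid (?Z \<boxtimes> M)" "?Z \<rhd> Hat (b_counit H) M" "Hat (b_counit H) (?Z \<boxtimes> M)" "br ?Z X M"]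
        Hat_brd_right [of "b_counit H" "\<langle>?Z\<rangle>" M] by (simp add: br_def)
    from this [THEN tcomp_left_cong] show ?thesis using that by (simp add: Hat_p counit)
  qed

  have p_coassoc: "Hat p (X \<boxtimes> M) \<star> Hat p M
      = (?Z \<rhd> tinv (br X X M)) \<star> (?Z \<rhd> Hat (b_comult H) M) \<star> Hat p M" if [simp]: "M \<in> Obj C" for M
  proof -
    \<comment> \<open>\<open>1\<close> and \<open>2\<close> are naturality of the inverse braiding
      for the coaction and for the comultiplication; \<open>3\<close> is the inverted Yang-Baxter
      relation.\<close>
    have 1: "Hat d (X \<boxtimes> M) \<star> tinv (br ?Z X M)
        = (X \<rhd> tinv (br ?Z X M)) \<star> tinv (br X X (?Z \<boxtimes> M)) \<star> (X \<rhd> Hat d M)"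
      using tinv_square [OF Hat_brd_left [of d "\<langle>X\<rangle>" M, simplified]]
      by (simp add: Hat_simps)
    have 2: "(?Z \<rhd> Hat (b_comult H) M) \<star> tinv (br ?Z X M)
        = tinv (br ?Z X (X \<boxtimes> M)) \<star> (X \<rhd> tinv (br ?Z X M)) \<star> Hat (b_comult H) (?Z \<boxtimes> M)"
      using tinv_square [OF Hat_brd_right [of "b_comult H" "\<langle>?Z\<rangle>" M, simplified]]
      by (simp add: Hat_simps)
    have 3: "(?Z \<rhd> tinv (br X X M)) \<star> tinv (br ?Z X (X \<boxtimes> M)) \<star> (X \<rhd> tinv (br ?Z X M))
        = tinv (br ?Z X (X \<boxtimes> M)) \<star> (X \<rhd> tinv (br ?Z X M)) \<star> tinv (br X X (?Z \<boxtimes> M))"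
      using arg_cong [OF Hat_brd_right [of "brd \<langle>X\<rangle> \<langle>X\<rangle>" "\<langle>?Z\<rangle>" M], of tinv]
      by (simp add: Hat_simps)
    have "Hat p (X \<boxtimes> M) \<star> Hat p M = (tinv (br ?Z X (X \<boxtimes> M)) \<star> (X \<rhd> tinv (br ?Z X M))
        \<star> tinv (br X X (?Z \<boxtimes> M))) \<star> (X \<rhd> Hat d M) \<star> Hat d M"
      by (simp add: Hat_p 1 [THEN tcomp_left_cong])
    also have "\<dots> = (?Z \<rhd> tinv (br X X M)) \<star> (?Z \<rhd> Hat (b_comult H) M) \<star> Hat p M"
      unfolding 3 [symmetric] by (simp add: Hat_p 2 [THEN tcomp_left_cong] coassoc)
    finally show ?thesis .
  qed

  have p_br: "br Xd ?Z (X \<boxtimes> M) \<star> (Xd \<rhd> Hat p M)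
      = (?Z \<rhd> tinv (br Xd X M)) \<star> Hat p (Xd \<boxtimes> M) \<star> br Xd ?Z M" if [simp]: "M \<in> Obj C" for M
  proof (rule iso_cancel_left [of "?Z \<rhd> br Xd X M"])
    show "(?Z \<rhd> br Xd X M) \<star> br Xd ?Z (X \<boxtimes> M) \<star> (Xd \<rhd> Hat p M)
      = (?Z \<rhd> br Xd X M) \<star> (?Z \<rhd> tinv (br Xd X M)) \<star> Hat p (Xd \<boxtimes> M) \<star> br Xd ?Z M"
      using Hat_brd_right [of p "\<langle>Xd\<rangle>" M] by (simp add: Hat_simps)
  qed auto

  \<comment> \<open>Naturality of the braiding for \<open>ev\<close>: an adjacent pair
    \<open>X\<close>, \<open>Xd\<close> slips over the third strand and becomes the inner
    pair.\<close>
  have ev_ev: "Hat b_ev M \<star> (X \<rhd> Xd \<rhd> Hat b_ev M) \<star> (X \<rhd> tinv (br Xd X (Xd \<boxtimes> M)))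
      \<star> tinv (br X X (Xd \<boxtimes> Xd \<boxtimes> M)) = Hat b_ev M \<star> (X \<rhd> Hat b_ev (Xd \<boxtimes> M))"
    if [simp]: "M \<in> Obj C" for M
  proof -
    have 1: "Hat b_ev (X \<boxtimes> Xd \<boxtimes> M) \<star> (X \<rhd> tinv (br Xd X (Xd \<boxtimes> M))) \<star> tinv (br X X (Xd \<boxtimes> Xd \<boxtimes> M))
        = X \<rhd> Hat b_ev (Xd \<boxtimes> M)"
      using Hat_brd_left [of b_ev "\<langle>X\<rangle>" "Xd \<boxtimes> M"]
        tinv_square [of "tid (X \<boxtimes> Xd \<boxtimes> M)" "Hat b_ev (X \<boxtimes> Xd \<boxtimes> M)" "X \<rhd> Hat b_ev (Xd \<boxtimes> M)"
          "Hat (brd (\<langle>X\<rangle> \<odot> \<langle>Xd\<rangle>) \<langle>X\<rangle>) (Xd \<boxtimes> M)"]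
      by (simp add: Hat_simps)
    have 2: "Hat b_ev M \<star> (X \<rhd> Xd \<rhd> Hat b_ev M) = Hat b_ev M \<star> Hat b_ev (X \<boxtimes> Xd \<boxtimes> M)"
      using Hat_natural [of b_ev "Hat b_ev M"] by simp
    show ?thesis by (simp add: 1 2 [THEN tcomp_left_cong])
  qed

  have Hat_Omega: "Hat (b_Omega d) M = (?Z \<rhd> Hat b_ev M) \<star> Hat p (Xd \<boxtimes> M) \<star> br Xd ?Z M"
    if "M \<in> Obj C" for M
    using that by (simp add: Hat_b_Omega Hat_p Hat_simps)
  have br_one: "br Xd ?Z M \<star> Hat (b_one K) (?Z \<boxtimes> M) = ?Z \<rhd> Hat (b_one K) M"
    and br_mult: "br Xd ?Z M \<star> Hat (b_mult K) (?Z \<boxtimes> M)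
      = (?Z \<rhd> Hat (b_mult K) M) \<star> br Xd ?Z (Xd \<boxtimes> M) \<star> (Xd \<rhd> br Xd ?Z M)" if [simp]: "M \<in> Obj C" for M
    using Hat_brd_left [of "b_one K" "\<langle>?Z\<rangle>" M] Hat_brd_left [of "b_mult K" "\<langle>?Z\<rangle>" M]
    by (simp_all add: Hat_simps)

  have "b_Omega d \<star> (b_one K \<uplus> bid z) = blunit z"
  proof (rule Hat_faithful)
    show "Hat (b_Omega d \<star> (b_one K \<uplus> bid z)) \<one> = Hat (blunit z) \<one>"
      by (simp add: Hat_simps Hat_Omega z_def br_one p_slide p_counit
          dual_ev(2) [THEN whisk_cong, THEN tcomp_left_cong])
  qed (auto simp: z_def)
  \<comment> \<open>By duality the left side is \<open>p\<close> followed by the comultiplication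
    and the nested pairing; two successive actions reach the same form through
    \<open>p_coassoc\<close> and \<open>ev_ev\<close>.\<close>
  moreover have "b_Omega d \<star> (b_mult K \<uplus> bid z) = b_Omega d \<star> (bid y \<uplus> b_Omega d) \<star> bassoc y y z"
  proof (rule Hat_faithful)
    have "Hat (b_Omega d \<star> (b_mult K \<uplus> bid z)) \<one>
        = (?Z \<rhd> (Hat b_ev \<one> \<star> (X \<rhd> Hat b_ev (Xd \<boxtimes> \<one>)))) \<star> (?Z \<rhd> Hat (b_comult H) (Xd \<boxtimes> Xd \<boxtimes> \<one>))
        \<star> Hat p (Xd \<boxtimes> Xd \<boxtimes> \<one>) \<star> br Xd ?Z (Xd \<boxtimes> \<one>) \<star> (Xd \<rhd> br Xd ?Z \<one>)"
      by (simp add: Hat_simps Hat_Omega z_def br_mult p_slide [THEN tcomp_left_cong]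
          dual_ev(1) [THEN whisk_cong, THEN tcomp_left_cong])
    also have "\<dots> = Hat (b_Omega d \<star> (bid y \<uplus> b_Omega d) \<star> bassoc y y z) \<one>"
      unfolding ev_ev [symmetric, OF unit_ob_in_Obj]
      by (simp add: Hat_simps Hat_Omega z_def y_def br_slide [THEN tcomp_left_cong]
          p_slide [THEN tcomp_left_cong] p_br [THEN tcomp_left_cong] p_coassoc [THEN tcomp_left_cong])
    finally show "Hat (b_Omega d \<star> (b_mult K \<uplus> bid z)) \<one>
      = Hat (b_Omega d \<star> (bid y \<uplus> b_Omega d) \<star> bassoc y y z) \<one>" .
  qed (auto simp: z_def y_def)
  moreover have "arr (b_Omega d) = act (Omega C H K ev coev Z)"
    by (rule arr_b_Omega) (simp_all add: d_def z_def)
  moreover have "barrow (b_Omega d)" by simp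
  ultimately show ?thesis
    by (simp add: is_module_def Let_def barrow_def tcomp_def arr_bracketed z_def y_def)
      (simp add: b_defs bdefs)
qed

section \<open>The two compatibility conditions\<close>

definition "b_half_braiding A f d = (f \<uplus> bid (src d)) \<star> binv (bassoc \<langle>carrier A\<rangle> (tgt f) (src d))
  \<star> (bid \<langle>carrier A\<rangle> \<uplus> brd (src d) (tgt f)) \<star> bassoc \<langle>carrier A\<rangle> (src d) (tgt f) \<star> (d \<uplus> bid (tgt f))"

lemma src_tgt_b_half_braiding [simp]:
  "src (b_half_braiding A f d) = src d \<odot> tgt f" "tgt (b_half_braiding A f d) = tgt f \<odot> src d"
  by (simp_all add: b_half_braiding_def)

lemma
  assumes "A = H \<or> A = K" "barrow f" "barrow d"
    "src f = \<langle>carrier A\<rangle> \<odot> tgt f" "tgt d = \<langle>carrier A\<rangle> \<odot> src d"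
  shows barrow_b_half_braiding: "barrow (b_half_braiding A f d)"
    and Hat_b_half_braiding: "N \<in> Obj C \<Longrightarrow> Hat (b_half_braiding A f d) N
      = Hat f (app (src d) N) \<star> (carrier A \<rhd> Hat (brd (src d) (tgt f)) N) \<star> Hat d (app (tgt f) N)"
proof -
  have "carrier A \<in> Obj C" using assms(1) by auto
  then show "barrow (b_half_braiding A f d)"
    and "N \<in> Obj C \<Longrightarrow> Hat (b_half_braiding A f d) N
      = Hat f (app (src d) N) \<star> (carrier A \<rhd> Hat (brd (src d) (tgt f)) N) \<star> Hat d (app (tgt f) N)"
    unfolding b_half_braiding_def using assms(2-)
    by (simp_all add: Hat_tcomp Hat_btensor Hat_binv)
qed

lemma arr_b_half_braiding:
  assumes "val (src d) = ob Z" "arr d = coact Z" "val (tgt f) = ob V" "arr f = act V"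
  shows "arr (b_half_braiding A f d) = half_braiding C A Z V"
  using assms by (simp add: b_half_braiding_def half_braiding_def Let_def brd_def bdefs)

text \<open>Condition (i) composed with \<open>a\<close>, which frees the statement of the
  inverse.\<close>

lemma left_compatibility:
  assumes f [simp]: "barrow f" "src f = \<langle>X\<rangle> \<odot> \<langle>V\<rangle>" "tgt f = \<langle>V\<rangle>"
    and d [simp]: "barrow d" "src d = \<langle>Z\<rangle>" "tgt d = \<langle>X\<rangle> \<odot> \<langle>Z\<rangle>"
    and M [simp]: "M \<in> Obj C"
  shows "b_mid f \<langle>M\<rangle> (b_Omega d) \<star> brd \<langle>Z\<rangle> (\<langle>V\<rangle> \<odot> \<langle>M\<rangle>)
    = (bid \<langle>V\<rangle> \<uplus> brd \<langle>Z\<rangle> \<langle>M\<rangle>) \<star> bassoc \<langle>V\<rangle> \<langle>Z\<rangle> \<langle>M\<rangle> \<star> (b_half_braiding H f d \<uplus> bid \<langle>M\<rangle>)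
      \<star> binv (bassoc \<langle>Z\<rangle> \<langle>V\<rangle> \<langle>M\<rangle>)" (is "?l = ?r")
proof -
  have [simp]: "V \<in> Obj C" "Z \<in> Obj C" using barrow_wf(2) [OF f(1)] barrow_wf(1) [OF d(1)] by simp_all
  have [simp]: "barrow (b_half_braiding H f d)" by (rule barrow_b_half_braiding) simp_all
  \<comment> \<open>Used for \<open>A = V\<close> and for \<open>A = M\<close>, this produces the
    crossings with \<open>X\<close> that cancel the inverse ones in \<open>b_mid\<close>.\<close>
  have d_br: "(A \<rhd> Hat d N) \<star> br Z A N = br X A (Z \<boxtimes> N) \<star> (X \<rhd> br Z A N) \<star> Hat d (A \<boxtimes> N)"
    if "A \<in> Obj C" "N \<in> Obj C" for A N
    using that Hat_brd_left [of d "\<langle>A\<rangle>" N] by (simp add: Hat_simps)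
  have f_slide: "Hat f N \<star> (X \<rhd> V \<rhd> h) = (V \<rhd> h) \<star> Hat f (src h)" if "arrow h" "tgt h = N" for h N
    using that Hat_natural [of f h] by simp
  note rules = d_br d_br [THEN whisk_cong, THEN tcomp_left_cong] f_slide [THEN tcomp_left_cong]
    tinv_br_slide [THEN tcomp_left_cong]
  show ?thesis
  proof (rule Hat_faithful)
    show "Hat ?l \<one> = Hat ?r \<one>"
      by (simp add: Hat_simps Hat_b_mid Hat_b_half_braiding b_coact_b_Omega rules)
  qed simp_all
qed

definition "b_Omega_coact r =
  (bid \<langle>Xd\<rangle> \<uplus> r) \<star> bassoc \<langle>Xd\<rangle> \<langle>X\<rangle> (tgt r) \<star> (b_coev \<uplus> bid (tgt r)) \<star> binv (blunit (tgt r))"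

lemma src_tgt_b_Omega_coact [simp]:
  "src (b_Omega_coact r) = tgt r" "tgt (b_Omega_coact r) = \<langle>Xd\<rangle> \<odot> tgt r"
  by (simp_all add: b_Omega_coact_def)

lemma
  assumes "barrow r" "src r = \<langle>X\<rangle> \<odot> tgt r"
  shows barrow_b_Omega_coact: "barrow (b_Omega_coact r)"
    and Hat_b_Omega_coact: "N \<in> Obj C \<Longrightarrow>
      Hat (b_Omega_coact r) N = (Xd \<rhd> Hat r N) \<star> Hat b_coev (app (tgt r) N)"
  unfolding b_Omega_coact_def using assms by (simp_all add: Hat_tcomp Hat_btensor Hat_binv)

lemma arr_b_Omega_coact:
  "\<lbrakk>val (tgt r) = ob Z; arr r = act Z\<rbrakk> \<Longrightarrow> arr (b_Omega_coact r) = coact (Omega C H K ev coev Z)"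
  by (simp add: b_Omega_coact_def Omega_def Let_def bdefs b_defs)

text \<open>Both sides join \<open>coev\<close>, \<open>g\<close> and \<open>r\<close> by crossings.
  Transparency makes the sense of each crossing with \<open>X\<close> immaterial, and naturality of
  the braiding then matches the rest.\<close>

lemma right_compatibility:
  assumes transparent: "\<And>U N. \<lbrakk>U \<in> Obj C; N \<in> Obj C\<rbrakk> \<Longrightarrow> br U X N \<star> br X U N = tid (X \<boxtimes> U \<boxtimes> N)"
    and r [simp]: "barrow r" "src r = \<langle>X\<rangle> \<odot> \<langle>Z\<rangle>" "tgt r = \<langle>Z\<rangle>"
    and g [simp]: "barrow g" "src g = \<langle>Xd\<rangle> \<odot> \<langle>W\<rangle>" "tgt g = \<langle>W\<rangle>"
    and M [simp]: "M \<in> Obj C"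
  shows "brd \<langle>Z\<rangle> (\<langle>M\<rangle> \<odot> \<langle>W\<rangle>) \<star> b_mid r \<langle>M\<rangle> g
    = binv (bassoc \<langle>M\<rangle> \<langle>W\<rangle> \<langle>Z\<rangle>) \<star> (bid \<langle>M\<rangle> \<uplus> b_half_braiding K g (b_Omega_coact r))
      \<star> bassoc \<langle>M\<rangle> \<langle>Z\<rangle> \<langle>W\<rangle> \<star> (brd \<langle>Z\<rangle> \<langle>M\<rangle> \<uplus> bid \<langle>W\<rangle>)" (is "?l = ?r")
proof -
  have [simp]: "W \<in> Obj C" "Z \<in> Obj C" using barrow_wf(2) [OF g(1)] barrow_wf(2) [OF r(1)] by simp_all
  have [simp]: "barrow (b_Omega_coact r)" by (rule barrow_b_Omega_coact) simp_all
  have [simp]: "barrow (b_half_braiding K g (b_Omega_coact r))"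
    by (rule barrow_b_half_braiding) simp_all
  have tinv_br: "tinv (br X A N) = br A X N" if "A \<in> Obj C" "N \<in> Obj C" for A N
    by (rule iso_cancel_right [of _ "br X A N"]) (use that in \<open>simp_all add: transparent\<close>)
  \<comment> \<open>The Yang-Baxter relation for \<open>Z\<close>, \<open>A\<close> and
    \<open>X\<close>, composed with \<open>br X A\<close>, which by transparency undoes the crossing
    \<open>br A X\<close>.\<close>
  have braid: "br X A (Z \<boxtimes> N) \<star> (X \<rhd> br Z A N) \<star> br Z X (A \<boxtimes> N) \<star> (Z \<rhd> br A X N)
      = (A \<rhd> br Z X N) \<star> br Z A (X \<boxtimes> N)" if "A \<in> Obj C" "N \<in> Obj C" for A N
  proof -
    have "(X \<rhd> br Z A N) \<star> br Z X (A \<boxtimes> N) \<star> (Z \<rhd> br A X N)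
        = br A X (Z \<boxtimes> N) \<star> (A \<rhd> br Z X N) \<star> br Z A (X \<boxtimes> N)"
      using that Hat_brd_right [of "brd \<langle>A\<rangle> \<langle>X\<rangle>" "\<langle>Z\<rangle>" N] by (simp add: Hat_simps)
    moreover have cancel: "br X A (Z \<boxtimes> N) \<star> br A X (Z \<boxtimes> N) = tid (A \<boxtimes> X \<boxtimes> Z \<boxtimes> N)"
      using that tcomp_tinv [of "br X A (Z \<boxtimes> N)"] by (simp add: tinv_br)
    ultimately show ?thesis using that by (simp add: cancel [THEN tcomp_left_cong])
  qed

  \<comment> \<open>\<open>t\<close> is the \<open>X\<close>-coaction of \<open>W\<close> before its
    final braiding (\<open>coact_g\<close>). It is the common core of the two sides: the
    half-braiding on the right contains it too (\<open>half\<close>).\<close>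
  define t where "t = (g \<uplus> bid \<langle>X\<rangle>) \<star> binv (bassoc \<langle>Xd\<rangle> \<langle>W\<rangle> \<langle>X\<rangle>) \<star> (bid \<langle>Xd\<rangle> \<uplus> brd \<langle>X\<rangle> \<langle>W\<rangle>)
    \<star> bassoc \<langle>Xd\<rangle> \<langle>X\<rangle> \<langle>W\<rangle> \<star> (b_coev \<uplus> bid \<langle>W\<rangle>) \<star> binv (blunit \<langle>W\<rangle>)"
  have t [simp]: "barrow t" "src t = \<langle>W\<rangle>" "tgt t = \<langle>W\<rangle> \<odot> \<langle>X\<rangle>" by (simp_all add: t_def)
  have Hat_t: "Hat t N = Hat g (X \<boxtimes> N) \<star> (Xd \<rhd> br X W N) \<star> Hat b_coev (W \<boxtimes> N)" if "N \<in> Obj C" for N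
    using that by (simp add: t_def Hat_simps)
  have coact_g: "Hat (b_coact g) N = br W X N \<star> Hat t N" if "N \<in> Obj C" for N
    using that by (simp add: Hat_b_coact Hat_simps Hat_t coev_slide)
  have t_br: "(W \<rhd> br Z X N) \<star> br Z W (X \<boxtimes> N) \<star> (Z \<rhd> Hat t N) = Hat t (Z \<boxtimes> N) \<star> br Z W N"
    if "N \<in> Obj C" for N
    using that Hat_brd_right [of t "\<langle>Z\<rangle>" N] by (simp add: Hat_simps)

  have r_br: "br Z A N \<star> Hat r (A \<boxtimes> N) = (A \<rhd> Hat r N) \<star> br X A (Z \<boxtimes> N) \<star> (X \<rhd> br Z A N)"
    if "A \<in> Obj C" "N \<in> Obj C" for A N
    using that Hat_brd_left [of r "\<langle>A\<rangle>" N] by (simp add: Hat_simps)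
  have g_slide: "Hat g N \<star> (Xd \<rhd> W \<rhd> h) = (W \<rhd> h) \<star> Hat g (src h)" if "arrow h" "tgt h = N" for h N
    using that Hat_natural [of g h] by simp
  have coev_slide': "(Xd \<rhd> X \<rhd> h) \<star> Hat b_coev N = Hat b_coev (tgt h) \<star> h" if "arrow h" "src h = N" for h N
    using that Hat_natural [of b_coev h] by simp

  have half: "Hat (b_half_braiding K g (b_Omega_coact r)) \<one> = (W \<rhd> Hat r \<one>) \<star> Hat t (Z \<boxtimes> \<one>) \<star> br Z W \<one>"
    by (simp add: Hat_simps Hat_b_half_braiding Hat_b_Omega_coact Hat_t coev_slide'
        r_br [THEN whisk_cong, THEN tcomp_left_cong] g_slide [THEN tcomp_left_cong])

  let ?c = "br Z M (W \<boxtimes> \<one>)"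
  \<comment> \<open>The action \<open>r\<close> moves left past the braiding with \<open>M\<close>;
    the four crossings around \<open>M\<close>, and afterwards those around \<open>W\<close>,
    collapse by \<open>braid\<close>, and \<open>t\<close> slides past \<open>Z\<close>.\<close>
  have "Hat ?l \<one> = (M \<rhd> (br Z W \<one> \<star> Hat r (W \<boxtimes> \<one>))) \<star> br X M (Z \<boxtimes> W \<boxtimes> \<one>) \<star> (X \<rhd> br Z M (W \<boxtimes> \<one>))
      \<star> br Z X (M \<boxtimes> W \<boxtimes> \<one>) \<star> (Z \<rhd> br M X (W \<boxtimes> \<one>)) \<star> (Z \<rhd> M \<rhd> Hat (b_coact g) \<one>)"
    by (simp add: Hat_simps Hat_b_mid tinv_br r_br [THEN tcomp_left_cong])
  also have "\<dots> = (M \<rhd> (br Z W \<one> \<star> Hat r (W \<boxtimes> \<one>))) \<star> (br X M (Z \<boxtimes> W \<boxtimes> \<one>) \<star> (X \<rhd> br Z M (W \<boxtimes> \<one>))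
      \<star> br Z X (M \<boxtimes> W \<boxtimes> \<one>) \<star> (Z \<rhd> br M X (W \<boxtimes> \<one>))) \<star> (Z \<rhd> M \<rhd> Hat (b_coact g) \<one>)"
    by simp
  also have "\<dots> = (M \<rhd> (br Z W \<one> \<star> Hat r (W \<boxtimes> \<one>) \<star> br Z X (W \<boxtimes> \<one>) \<star> (Z \<rhd> Hat (b_coact g) \<one>))) \<star> ?c"
    by (simp add: braid br_slide)
  also have "br Z W \<one> \<star> Hat r (W \<boxtimes> \<one>) \<star> br Z X (W \<boxtimes> \<one>) \<star> (Z \<rhd> Hat (b_coact g) \<one>)
      = (W \<rhd> Hat r \<one>) \<star> (br X W (Z \<boxtimes> \<one>) \<star> (X \<rhd> br Z W \<one>) \<star> br Z X (W \<boxtimes> \<one>) \<star> (Z \<rhd> br W X \<one>))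
        \<star> (Z \<rhd> Hat t \<one>)"
    by (simp add: coact_g r_br [THEN tcomp_left_cong])
  also have "\<dots> = (W \<rhd> Hat r \<one>) \<star> Hat t (Z \<boxtimes> \<one>) \<star> br Z W \<one>"
    by (simp add: braid t_br)
  also have "(M \<rhd> (\<dots>)) \<star> ?c = Hat ?r \<one>"
    unfolding half [symmetric] by (simp add: Hat_simps)
  finally have "Hat ?l \<one> = Hat ?r \<one>" .
  then show ?thesis by (rule Hat_faithful) simp_all
qed

end

section \<open>Return to the bare arrows of \<open>C\<close> and to the modules of the
  statement\<close>

theorem lemma3p6:
  fixes C :: "('o, 'm) braided" (structure)
    and X Xd :: "('o, 'm) hopf"
    and ev coev :: 'm
  defines "\<Omega> \<equiv> Omega C X Xd ev coev"
    and "\<M> \<equiv> bimod_M C X Xd coev"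
  assumes "braided_monoidal_category C"
    and "hopf_algebra C X"
    and "is_iso C (carrier X) (carrier X) (antipode X)"
    and "dual_hopf_algebra C X Xd ev coev"
    and "bimodule_category (Mod C X) (Mod C Xd) \<M>"
  shows
    "\<exists>\<psi> :: ('o, 'm) ydmod \<Rightarrow> 'o \<Rightarrow> 'm.
       (\<forall>Z \<in> Obj (YD C X). \<forall>M \<in> Obj C.
          is_iso C (ob Z \<boxtimes> M) (M \<boxtimes> ob (\<Omega> Z)) (\<psi> Z M))
     \<and> (\<forall>Z \<in> Obj (YD C X). \<forall>Z' \<in> Obj (YD C X). \<forall>M \<in> Obj C. \<forall>M' \<in> Obj C.
          \<forall>f \<in> Hom (YD C X) Z Z'. \<forall>g \<in> Hom C M M'.
            \<psi> Z' M' \<cdot> (f \<otimes> g) = (g \<otimes> f) \<cdot> \<psi> Z M)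
     \<and> (\<forall>Z \<in> Obj (YD C X). \<forall>M \<in> Obj C. \<forall>V \<in> Obj (Mod C X).
          \<psi> Z (ob V \<boxtimes> M)
          = inverse_arrow C
              ((ob V \<boxtimes> M) \<boxtimes> ob (\<Omega> Z)) (ob V \<boxtimes> (M \<boxtimes> ob (\<Omega> Z)))
              (mid \<M> V M (lmod.truncate (\<Omega> Z)))
            \<cdot> (\<ii> (ob V) \<otimes> \<psi> Z M)
            \<cdot> \<alpha> (ob V) (ob Z) M
            \<cdot> (half_braiding C X Z V \<otimes> \<ii> M)
            \<cdot> \<alpha>' (ob Z) (ob V) M)
     \<and> (\<forall>Z \<in> Obj (YD C X). \<forall>M \<in> Obj C. \<forall>W \<in> Obj (Mod C Xd).
          \<psi> Z (M \<boxtimes> ob W) \<cdot> mid \<M> (lmod.truncate Z) M W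
          = \<alpha>' M (ob W) (ob (\<Omega> Z))
            \<cdot> (\<ii> M \<otimes> half_braiding C Xd (\<Omega> Z) W)
            \<cdot> \<alpha> M (ob (\<Omega> Z)) (ob W)
            \<cdot> (\<psi> Z M \<otimes> \<ii> (ob W)))"
proof -
  interpret hopf_pair C X Xd ev coev
    using assms by (intro hopf_pair.intro hopf_pair_axioms.intro)
  note bim = assms(7) [unfolded \<M>_def]
  have ob_Omega [simp]: "ob (\<Omega> Z) = ob Z" for Z by (simp add: \<Omega>_def Omega_def Let_def)
  have YD: "is_module C X (ob Z) (act Z)" "is_comodule C X (ob Z) (coact Z)" "ob Z \<in> Obj C"
    if "Z \<in> Obj (YD C X)" for Z
    using that by (simp_all add: YD_def is_module_def Let_def)
  have Mod: "is_module C X (ob V) (act V)" "ob V \<in> Obj C" if "V \<in> Obj (Mod C X)" for V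
    using that by (simp_all add: Mod_def is_module_def Let_def)
  have Mod': "is_module C Xd (ob W) (act W)" "ob W \<in> Obj C" if "W \<in> Obj (Mod C Xd)" for W
    using that by (simp_all add: Mod_def is_module_def Let_def)
  let ?act = "\<lambda>A V r. TArr (\<langle>carrier A\<rangle> \<odot> \<langle>V\<rangle>) r \<langle>V\<rangle>"
    and ?coact = "\<lambda>Z. TArr \<langle>ob Z\<rangle> (coact Z) (\<langle>carrier X\<rangle> \<odot> \<langle>ob Z\<rangle>)"
  have act: "barrow (?act A V r)" if "is_module C A V r" "A = X \<or> A = Xd" for A V r
    using that by (auto simp: barrow_def is_module_def Let_def)
  have coact: "barrow (?coact Z)" if "is_comodule C X (ob Z) (coact Z)" for Z
    using that by (simp add: barrow_def is_comodule_def Let_def)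
  have arr_brd: "arr (brd a b) = \<cc> (val a) (val b)" for a b by (simp add: brd_def)

  have left: "\<cc> (ob Z) (ob V \<boxtimes> M)
      = inverse_arrow C
          ((ob V \<boxtimes> M) \<boxtimes> ob (\<Omega> Z)) (ob V \<boxtimes> (M \<boxtimes> ob (\<Omega> Z)))
          (mid \<M> V M (lmod.truncate (\<Omega> Z)))
        \<cdot> (\<ii> (ob V) \<otimes> \<cc> (ob Z) M)
        \<cdot> \<alpha> (ob V) (ob Z) M
        \<cdot> (half_braiding C X Z V \<otimes> \<ii> M)
        \<cdot> \<alpha>' (ob Z) (ob V) M"
    if Z: "Z \<in> Obj (YD C X)" and M: "M \<in> Obj C" and V: "V \<in> Obj (Mod C X)" for Z M V
  proof (rule eq_inverse_arrow_Comp [where D = "ob Z \<boxtimes> ob V \<boxtimes> M"])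
    let ?f = "?act X (ob V) (act V)" and ?d = "?coact Z" and ?W = "lmod.truncate (\<Omega> Z)"
    have f: "barrow ?f" and d: "barrow ?d"
      using act [OF Mod(1) [OF V]] coact [OF YD(2) [OF Z]] by simp_all
    have W: "?W \<in> Obj (Mod C Xd)"
      using module_Omega [OF YD(2) [OF Z]] by (simp add: Mod_def \<Omega>_def Omega_def lmod.defs Let_def)
    then show "is_iso C ((ob V \<boxtimes> M) \<boxtimes> ob (\<Omega> Z)) (ob V \<boxtimes> M \<boxtimes> ob (\<Omega> Z)) (mid \<M> V M ?W)"
      using bimodule_category.mid_iso [OF bim V _ W, of M] M
      by (simp add: \<M>_def bimod_M_def is_iso_def inverse_arrows_def lmod.defs)
    show "\<cc> (ob Z) (ob V \<boxtimes> M) \<in> Hom C (ob Z \<boxtimes> ob V \<boxtimes> M) ((ob V \<boxtimes> M) \<boxtimes> ob (\<Omega> Z))"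
      using braid_iso [of "ob Z" "ob V \<boxtimes> M"] YD(3) [OF Z] Mod(2) [OF V] M
      by (auto simp: is_iso_def inverse_arrows_def)
    have "arr (b_mid ?f \<langle>M\<rangle> (b_Omega ?d)) = mid \<M> V M ?W"
      using arr_b_mid [of ?f V "\<langle>M\<rangle>" M "b_Omega ?d" ?W] arr_b_Omega [of ?d Z]
      by (simp add: \<M>_def bimod_M_def \<Omega>_def Omega_def lmod.defs Let_def)
    then show "mid \<M> V M ?W \<cdot> \<cc> (ob Z) (ob V \<boxtimes> M) = (\<ii> (ob V) \<otimes> \<cc> (ob Z) M)
        \<cdot> \<alpha> (ob V) (ob Z) M \<cdot> (half_braiding C X Z V \<otimes> \<ii> M) \<cdot> \<alpha>' (ob Z) (ob V) M"
      using arg_cong [OF left_compatibility [OF f _ _ d, of "ob V" "ob Z" M], of arr] M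
        arr_b_half_braiding [of ?d Z ?f V X]
      by (simp add: arr_bracketed arr_brd)
  qed (use M YD(3) [OF Z] Mod(2) [OF V] in auto)

  have right: "\<cc> (ob Z) (M \<boxtimes> ob W) \<cdot> mid \<M> (lmod.truncate Z) M W
      = \<alpha>' M (ob W) (ob (\<Omega> Z))
        \<cdot> (\<ii> M \<otimes> half_braiding C Xd (\<Omega> Z) W)
        \<cdot> \<alpha> M (ob (\<Omega> Z)) (ob W)
        \<cdot> (\<cc> (ob Z) M \<otimes> \<ii> (ob W))"
    if Z: "Z \<in> Obj (YD C X)" and M: "M \<in> Obj C" and W: "W \<in> Obj (Mod C Xd)" for Z M W
  proof -
    let ?r = "?act X (ob Z) (act Z)" and ?g = "?act Xd (ob W) (act W)"
    have r: "barrow ?r" and g: "barrow ?g"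
      using act [OF YD(1) [OF Z]] act [OF Mod'(1) [OF W]] by simp_all
    have "arr (b_mid ?r \<langle>M\<rangle> ?g) = mid \<M> (lmod.truncate Z) M W"
      using arr_b_mid [of ?r "lmod.truncate Z" "\<langle>M\<rangle>" M ?g W]
      by (simp add: \<M>_def bimod_M_def lmod.defs)
    moreover have "arr (b_half_braiding Xd ?g (b_Omega_coact ?r)) = half_braiding C Xd (\<Omega> Z) W"
      using arr_b_half_braiding [of "b_Omega_coact ?r" "\<Omega> Z" ?g W Xd] arr_b_Omega_coact [of ?r Z]
        ob_Omega [of Z]
      by (simp add: \<Omega>_def)
    ultimately show ?thesis
      using arg_cong [OF right_compatibility [OF transparent [OF bim] r _ _ g, of "ob Z" "ob W" M], of arr] M
      by (simp add: arr_bracketed arr_brd)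
  qed

  show ?thesis
  \<comment> \<open>The witness sees \<open>Z\<close> only through its underlying object, which
    \<open>\<Omega>\<close> keeps; as \<open>\<Omega>\<close> is the identity on arrows, naturality
    of \<open>\<psi>\<close> is that of the braiding.\<close>
  proof (intro exI [of _ "\<lambda>Z M. \<cc> (ob Z) M"] conjI ballI)
    fix Z M assume "Z \<in> Obj (YD C X)" "M \<in> Obj C"
    then show "is_iso C (ob Z \<boxtimes> M) (M \<boxtimes> ob (\<Omega> Z)) (\<cc> (ob Z) M)"
      using YD(3) by (simp add: braid_iso)
  next
    fix Z Z' M M' f g
    assume "Z \<in> Obj (YD C X)" "Z' \<in> Obj (YD C X)" "M \<in> Obj C" "M' \<in> Obj C"
      "f \<in> Hom (YD C X) Z Z'" "g \<in> Hom C M M'"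
    then show "\<cc> (ob Z') M' \<cdot> (f \<otimes> g) = (g \<otimes> f) \<cdot> \<cc> (ob Z) M"
      using YD(3) by (intro braid_natural) (auto simp: YD_def)
  qed (use left right in auto)
qed

end
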